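(* Let $(\mathcal{L},\Delta,S)$ be a locality and let $\mathcal{M},\mathcal{N}$ be partial normal subgroups of $\mathcal{L}$. Then $\mathcal{M}\mathcal{N}=\mathcal{N}\mathcal{M}$ is a partial normal subgroup of $\mathcal{L}$ and $(\mathcal{M}\mathcal{N})\cap S=(\mathcal{M}\cap S)(\mathcal{N}\cap S)$. Moreover, for every $g\in\mathcal{M}\mathcal{N}$ there exist $m\in\mathcal{M}$ and $n\in\mathcal{N}$ such that $(m,n)\in\mathbf{D}$, $g=\Pi(m,n)$ and $S_g=S_{(m,n)}$.
   Context: **Partial groups.** For a set $\mathcal{L}$ let $\mathbf{W}(\mathcal{L})$ be the set of (finite, possibly empty) words in $\mathcal{L}$, with $\circ$ denoting concatenation and $\emptyset$ the empty word; elements of $\mathcal{L}$ are identified with words of length one. A partial group is a non-empty set $\mathcal{L}$ with a subset $\mathbf{D}\subseteq\mathbf{W}(\mathcal{L})$, a map $\Pi\colon\mathbf{D}\to\mathcal{L}$ (the product) and an involutory bijection $f\mapsto f^{-1}$ of $\mathcal{L}$ (the inversion), extended to words by $(f_1,\dots,f_n)^{-1}=(f_n^{-1},\dots,f_1^{-1})$, such that: (1) $\mathcal{L}\subseteq\mathbf{D}$, and $u\circ v\in\mathbf{D}$ implies $u,v\in\mathbf{D}$; (2) $\Pi$ restricts to the identity on $\mathcal{L}$; (3) if $u\circ v\circ w\in\mathbf{D}$ then $u\circ(\Pi(v))\circ w\in\mathbf{D}$ and $\Pi(u\circ v\circ w)=\Pi(u\circ(\Pi(v))\circ w)$; (4)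 if $w\in\mathbf{D}$ then $w^{-1}\circ w\in\mathbf{D}$ and $\Pi(w^{-1}\circ w)=\mathbf{1}$, where $\mathbf{1}:=\Pi(\emptyset)$. **Subobjects and products.** A non-empty subset $\mathcal{H}\subseteq\mathcal{L}$ is a partial subgroup if $h^{-1}\in\mathcal{H}$ for all $h\in\mathcal{H}$ and $\Pi(v)\in\mathcal{H}$ for all $v\in\mathbf{W}(\mathcal{H})\cap\mathbf{D}$. It is a subgroup of $\mathcal{L}$ if moreover $\mathbf{W}(\mathcal{H})\subseteq\mathbf{D}$ (then $\mathcal{H}$ is a group under $\Pi$); a $p$-subgroup is a subgroup whose order is a power of the prime $p$. For $g\in\mathcal{L}$ let $\mathbf{D}(g)=\{x\in\mathcal{L}\colon (g^{-1},x,g)\in\mathbf{D}\}$ and, for $x\in\mathbf{D}(g)$, $x^g:=\Pi(g^{-1},x,g)$; for $X\subseteq\mathbf{D}(g)$ put $X^g=\{x^g\colon x\in X\}$. A partial subgroup $\mathcal{N}$ is a partial normal subgroup if $x^f\in\mathcal{N}$ for all $f\in\mathcal{L}$ and $x\in\mathcal{N}\cap\mathbf{D}(f)$. For subsets $X,Y\subseteq\mathcal{L}$, $XY:=\{\Pi(x,y)\colon x\in X,\ y\in Y,\ (x,y)\in\mathbf{D}\}$. **Localities.** Let $p$ be a prime. $(\mathcal{L},\Delta,S)$ is a locality if $\mathcal{L}$ is a partial group that is finite as a set, $S$ is a $p$-subgroup of $\mathcal{L}$, $\Delta$ is a non-empty set of subgroups of $S$, and: (L1) $S$ is maximal with respect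 to inclusion among the $p$-subgroups of $\mathcal{L}$; (L2) a word $(f_1,\dots,f_n)\in\mathbf{W}(\mathcal{L})$ lies in $\mathbf{D}$ if and only if there exist $P_0,\dots,P_n\in\Delta$ with $P_{i-1}\subseteq\mathbf{D}(f_i)$ and $P_{i-1}^{f_i}=P_i$ for $i=1,\dots,n$; (L3) if $Q$ is a subgroup of $S$ for which there exist $P\in\Delta$ and $g\in\mathcal{L}$ with $P\subseteq\mathbf{D}(g)$ and $P^g\le Q$, then $Q\in\Delta$. **The sets $S_g$ and $S_v$.** For $g\in\mathcal{L}$, $S_g=\{s\in S\colon s\in\mathbf{D}(g),\ s^g\in S\}$. For a word $v=(g_1,\dots,g_n)$ in $\mathcal{L}$, $S_v$ is the set of all $s\in S$ for which there exist $x_0,\dots,x_n\in S$ with $s=x_0$, $(g_i^{-1},x_{i-1},g_i)\in\mathbf{D}$ and $x_{i-1}^{g_i}=x_i$ for $i=1,\dots,n$. *)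

theory Defs
  imports "HOL-Algebra.Congruence" "HOL-Computational_Algebra.Primes"
begin

text \<open>
  Words are lists. The values of \<open>wprod\<close> outside \<open>wdom\<close> and of \<open>winv\<close> outside the carrier are
  irrelevant.
\<close>

record 'a partial_group = "'a partial_object" +
  wdom :: "'a list set"
  wprod :: "'a list \<Rightarrow> 'a"
  winv :: "'a \<Rightarrow> 'a"

definition word_inv :: "('a, 'b) partial_group_scheme \<Rightarrow> 'a list \<Rightarrow> 'a list" where
  "word_inv L w = map (winv L) (rev w)"

locale partial_group =
  fixes L :: "('a, 'b) partial_group_scheme"
  assumes carrier_nonempty: "carrier L \<noteq> {}"
    and wdom_words: "wdom L \<subseteq> lists (carrier L)"
    and wprod_closed: "w \<in> wdom L \<Longrightarrow> wprod L w \<in> carrier L"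
    and winv_bij: "bij_betw (winv L) (carrier L) (carrier L)"
    and winv_winv: "f \<in> carrier L \<Longrightarrow> winv L (winv L f) = f"
    and singleton_wdom: "f \<in> carrier L \<Longrightarrow> [f] \<in> wdom L"
    and append_wdom: "u @ v \<in> wdom L \<Longrightarrow> u \<in> wdom L \<and> v \<in> wdom L"
    and wprod_singleton: "f \<in> carrier L \<Longrightarrow> wprod L [f] = f"
    and wprod_assoc: "u @ v @ w \<in> wdom L \<Longrightarrow>
      u @ [wprod L v] @ w \<in> wdom L \<and> wprod L (u @ v @ w) = wprod L (u @ [wprod L v] @ w)"
    and wprod_inv: "w \<in> wdom L \<Longrightarrow>
      word_inv L w @ w \<in> wdom L \<and> wprod L (word_inv L w @ w) = wprod L []"

definition partial_subgroup :: "('a, 'b) partial_group_scheme \<Rightarrow> 'a set \<Rightarrow> bool" where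
  "partial_subgroup L H \<longleftrightarrow>
     H \<noteq> {} \<and> H \<subseteq> carrier L \<and>
     (\<forall>h\<in>H. winv L h \<in> H) \<and>
     (\<forall>v\<in>lists H \<inter> wdom L. wprod L v \<in> H)"

definition pg_subgroup :: "('a, 'b) partial_group_scheme \<Rightarrow> 'a set \<Rightarrow> bool" where
  "pg_subgroup L H \<longleftrightarrow> partial_subgroup L H \<and> lists H \<subseteq> wdom L"

definition pg_p_subgroup :: "nat \<Rightarrow> ('a, 'b) partial_group_scheme \<Rightarrow> 'a set \<Rightarrow> bool" where
  "pg_p_subgroup p L H \<longleftrightarrow> pg_subgroup L H \<and> finite H \<and> (\<exists>k::nat. card H = p ^ k)"

definition conj_dom :: "('a, 'b) partial_group_scheme \<Rightarrow> 'a \<Rightarrow> 'a set" where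
  "conj_dom L g = {x \<in> carrier L. [winv L g, x, g] \<in> wdom L}"

definition conj_elt :: "('a, 'b) partial_group_scheme \<Rightarrow> 'a \<Rightarrow> 'a \<Rightarrow> 'a" where
  "conj_elt L x g = wprod L [winv L g, x, g]"

definition conj_set :: "('a, 'b) partial_group_scheme \<Rightarrow> 'a set \<Rightarrow> 'a \<Rightarrow> 'a set" where
  "conj_set L X g = (\<lambda>x. conj_elt L x g) ` X"

definition partial_normal_subgroup :: "('a, 'b) partial_group_scheme \<Rightarrow> 'a set \<Rightarrow> bool" where
  "partial_normal_subgroup L N \<longleftrightarrow>
     partial_subgroup L N \<and>
     (\<forall>f\<in>carrier L. \<forall>x\<in>N \<inter> conj_dom L f. conj_elt L x f \<in> N)"

definition pg_set_mult :: "('a, 'b) partial_group_scheme \<Rightarrow> 'a set \<Rightarrow> 'a set \<Rightarrow> 'a set" where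
  "pg_set_mult L X Y = {wprod L [x, y] | x y. x \<in> X \<and> y \<in> Y \<and> [x, y] \<in> wdom L}"

text \<open>
  A subgroup of the group \<open>S\<close> is the same thing as a subgroup of \<open>L\<close> contained in \<open>S\<close>.
  In \<open>locality_overgroup\<close>, the relation \<open>P\<^sup>g \<le> Q\<close> is read as ``is a subgroup of'', which is why
  \<open>P\<^sup>g\<close> is explicitly required to be a subgroup there.
\<close>

locale locality = partial_group L
  for p :: nat and L :: "('a, 'b) partial_group_scheme" and \<Delta> :: "'a set set" and S :: "'a set" +
  assumes prime_p: "prime p"
    and finite_carrier: "finite (carrier L)"
    and S_p_subgroup: "pg_p_subgroup p L S"
    and objects_nonempty: "\<Delta> \<noteq> {}"
    and objects_subgroups: "P \<in> \<Delta> \<Longrightarrow> pg_subgroup L P \<and> P \<subseteq> S"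
    and S_maximal: "pg_p_subgroup p L T \<Longrightarrow> S \<subseteq> T \<Longrightarrow> T = S"
    and locality_wdom: "w \<in> lists (carrier L) \<Longrightarrow>
      w \<in> wdom L \<longleftrightarrow>
      (\<exists>P :: nat \<Rightarrow> 'a set.
         (\<forall>i\<le>length w. P i \<in> \<Delta>) \<and>
         (\<forall>i<length w. P i \<subseteq> conj_dom L (w ! i) \<and> conj_set L (P i) (w ! i) = P (Suc i)))"
    and locality_overgroup:
      "pg_subgroup L Q \<Longrightarrow> Q \<subseteq> S \<Longrightarrow> P \<in> \<Delta> \<Longrightarrow> g \<in> carrier L \<Longrightarrow>
       P \<subseteq> conj_dom L g \<Longrightarrow> pg_subgroup L (conj_set L P g) \<Longrightarrow> conj_set L P g \<subseteq> Q \<Longrightarrow>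
       Q \<in> \<Delta>"

definition S_elt :: "('a, 'b) partial_group_scheme \<Rightarrow> 'a set \<Rightarrow> 'a \<Rightarrow> 'a set" where
  "S_elt L S g = {s \<in> S. s \<in> conj_dom L g \<and> conj_elt L s g \<in> S}"

definition S_word :: "('a, 'b) partial_group_scheme \<Rightarrow> 'a set \<Rightarrow> 'a list \<Rightarrow> 'a set" where
  "S_word L S v =
     {s \<in> S. \<exists>x :: nat \<Rightarrow> 'a.
        (\<forall>i\<le>length v. x i \<in> S) \<and> s = x 0 \<and>
        (\<forall>i<length v. [winv L (v ! i), x i, v ! i] \<in> wdom L \<and>
                      conj_elt L (x i) (v ! i) = x (Suc i))}"

end

theory Submission
  imports Defs "HOL-Algebra.Sylow" "HOL-Algebra.Group_Action" "HOL-Algebra.Zassenhaus"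
    "HOL-Algebra.Multiplicative_Group"
begin

text \<open>
  Put \<open>K = M \<inter> N\<close> and \<open>J = MS \<inter> NS\<close>, a partial subgroup containing \<open>S\<close>. Since \<open>J/K\<close> behaves like a
  \<open>p\<close>-group, \<open>N\<^sub>J(R) = N\<^sub>K(R) N\<^sub>S(R)\<close> whenever \<open>N\<^sub>S(R)\<close> is a Sylow subgroup of \<open>N\<^sub>J(R)\<close>, and every
  object \<open>R\<close> has a \<open>KS\<close>-conjugate with this property. Consequently each \<open>p\<close>-subgroup of \<open>N\<^sub>J(R)\<close> can be
  conjugated into \<open>S\<close> by an element \<open>k\<close> of \<open>K\<close>.

  Among the factorizations \<open>g = mn\<close> choose one with \<open>P = S\<^bsub>(m,n)\<^esub>\<close> maximal. If \<open>P \<noteq> S\<^sub>g\<close>, let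
  \<open>P < A \<le> S\<^sub>g\<close> with \<open>A\<close> normalizing \<open>P\<close>. Then \<open>A\<^sup>m\<close> is a \<open>p\<close>-subgroup of \<open>N\<^sub>J(P\<^sup>m)\<close>, being conjugate to
  subgroups of \<open>S\<close> by \<open>m\<close> and by \<open>n\<^sup>-\<^sup>1\<close>, and passing to \<open>(mk, k\<^sup>-\<^sup>1n)\<close> enlarges \<open>P\<close> to \<open>A\<close>. In the same way
  every \<open>n \<in> N\<close> is a product \<open>hk\<close> with \<open>h \<in> N\<close> normalizing \<open>M \<inter> S\<close>, \<open>k \<in> K\<close> and \<open>S\<^sub>n = S\<^bsub>(h,k)\<^esub>\<close>. As
  \<open>m\<close> may be moved past such an \<open>h\<close>, this gives \<open>MN = NM\<close>, and with \<open>N = L\<close> it reduces invariance of \<open>MN\<close>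
  under conjugation to elements normalizing \<open>M \<inter> S\<close>.
\<close>

section \<open>Finite groups\<close>

text \<open>Orbit lengths divide \<open>p ^ k\<close>, and an orbit of length 1 consists of a fixed
  point. So the non-fixed points form a union of orbits whose lengths are divisible by
  \<open>p\<close>.\<close>

lemma (in group_action) prime_dvd_card_nonfixed:
  assumes p: "prime p" and ord: "order G = p ^ k" and finE: "finite E"
  shows "p dvd card (E - {x \<in> E. \<forall>g\<in>carrier G. (\<phi> g) x = x})"
proof -
  define F where "F = {x \<in> E. \<forall>g\<in>carrier G. (\<phi> g) x = x}"
  have "finite (carrier G)"
    using ord p by (metis card.infinite order_def power_not_zero prime_gt_0_nat less_irrefl)
  have orbF: "orbit G \<phi> x = {x}" if "x \<in> F" for x
    using that orbit_refl[of x] unfolding F_def orbit_def by auto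
  have inner: "p dvd (\<Sum>y\<in>orb. of_bool (y \<notin> F))" if orb: "orb \<in> orbits G E \<phi>" for orb
  proof -
    obtain x where x: "x \<in> E" "orb = orbit G \<phi> x"
      using orb unfolding orbits_def by blast
    show ?thesis
    proof (cases "x \<in> F")
      case True
      then show ?thesis using orbF x by simp
    next
      case False
      have sub: "orb \<subseteq> E"
        using x element_image unfolding orbit_def by auto
      have "y \<notin> F" if "y \<in> orb" for y
      proof
        assume "y \<in> F"
        moreover have "x \<in> orbit G \<phi> y"
          using orbit_sym[OF x(1)] that x sub by auto
        ultimately show False using orbF False by auto
      qed
      hence "(\<Sum>y\<in>orb. of_bool (y \<notin> F)) = card orb"
        by simp
      moreover have "card orb dvd p ^ k"
        using orbit_stabilizer_theorem[OF x(1)] ord x(2) by (metis dvd_triv_left)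
      then obtain i where i: "card orb = p ^ i"
        using p divides_primepow_nat by blast
      moreover have "i \<noteq> 0"
      proof
        assume "i = 0"
        hence "card orb = 1" using i by simp
        then obtain z where z: "orb = {z}" by (auto simp: card_1_singleton_iff)
        moreover have "x \<in> orb" using orbit_refl x by auto
        ultimately have "orbit G \<phi> x = {x}" using x by auto
        hence "x \<in> F" using x(1) unfolding F_def orbit_def by auto
        with False show False ..
      qed
      ultimately show ?thesis by simp
    qed
  qed
  \<comment> \<open>Written as a sum of indicators over \<open>E\<close>, the cardinality can be
    regrouped by orbits.\<close>
  have "card (E - F) = (\<Sum>x\<in>E. of_bool (x \<notin> F))"
    using finE by (simp add: sum.If_cases of_bool_def Diff_eq Collect_neg_eq[symmetric] Int_def)
  also have "\<dots> = (\<Sum>orb\<in>orbits G E \<phi>. \<Sum>x\<in>orb. of_bool (x \<notin> F))"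
    using disjoint_sum[OF finE] by metis
  also have "p dvd \<dots>" by (intro dvd_sum inner)
  finally show ?thesis unfolding F_def .
qed

section \<open>Sylow theory by counting fixed cosets\<close>

context group begin

text \<open>Right translation reverses products, so \<open>b\<close> acts through
  \<open>inv b\<close> to give a homomorphism. The maps are restricted to \<open>rcosets P\<close>
  because \<open>Bij\<close> consists of extensional functions.\<close>

lemma rcoset_translation_action:
  assumes P: "subgroup P G" and B: "subgroup B G"
  shows "group_action (G\<lparr>carrier := B\<rparr>) (rcosets P) (\<lambda>b. \<lambda>C\<in>rcosets P. C #> inv b)"
proof -
  have PG: "P \<subseteq> carrier G" and BG: "B \<subseteq> carrier G"
    using P B subgroup.subset by auto
  have CG: "C \<subseteq> carrier G" if "C \<in> rcosets P" for C
    using that PG r_coset_subset_G unfolding RCOSETS_def by blast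
  have closed: "C #> b \<in> rcosets P" if C: "C \<in> rcosets P" and b: "b \<in> carrier G" for C b
  proof -
    obtain g where "g \<in> carrier G" "C = P #> g"
      using C unfolding RCOSETS_def by auto
    thus ?thesis using b PG
      by (simp add: coset_mult_assoc rcosetsI)
  qed
  define \<phi> where "\<phi> = (\<lambda>b. \<lambda>C\<in>rcosets P. C #> inv b)"
  have comp: "\<phi> (a \<otimes> b) = compose (rcosets P) (\<phi> a) (\<phi> b)" if "a \<in> B" "b \<in> B" for a b
  proof -
    have ab: "a \<in> carrier G" "b \<in> carrier G" using that BG by auto
    show ?thesis
      unfolding \<phi>_def compose_def
    proof (rule restrict_ext)
      fix C assume C: "C \<in> rcosets P"
      show "C #> inv (a \<otimes> b) = (\<lambda>C\<in>rcosets P. C #> inv a) ((\<lambda>C\<in>rcosets P. C #> inv b) C)"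
        using ab C closed[OF C, of "inv b"] CG[OF C]
        by (simp add: inv_mult_group coset_mult_assoc)
    qed
  qed
  have id: "compose (rcosets P) (\<phi> (inv a)) (\<phi> a) = (\<lambda>C\<in>rcosets P. C)" if "a \<in> carrier G" for a
    unfolding \<phi>_def compose_def
  proof (rule restrict_ext)
    fix C assume C: "C \<in> rcosets P"
    show "(\<lambda>C\<in>rcosets P. C #> inv (inv a)) ((\<lambda>C\<in>rcosets P. C #> inv a) C) = C"
      using that C closed[OF C, of "inv a"] CG[OF C]
      by (simp add: coset_mult_assoc coset_mult_one)
  qed
  have bij: "\<phi> a \<in> Bij (rcosets P)" if "a \<in> carrier G" for a
  proof -
    have a': "inv a \<in> carrier G" using that by simp
    have "bij_betw (\<phi> a) (rcosets P) (rcosets P)"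
    proof (rule bij_betw_byWitness[where f' = "\<phi> (inv a)"])
      show "\<forall>C\<in>rcosets P. \<phi> (inv a) (\<phi> a C) = C"
        using id[OF that] by (metis compose_eq restrict_apply')
      show "\<forall>C\<in>rcosets P. \<phi> a (\<phi> (inv a) C) = C"
        using id[OF a'] that by (metis compose_eq restrict_apply' inv_inv)
      show "\<phi> a ` (rcosets P) \<subseteq> rcosets P" "\<phi> (inv a) ` (rcosets P) \<subseteq> rcosets P"
        unfolding \<phi>_def using closed that by auto
    qed
    thus ?thesis unfolding Bij_def by (simp add: \<phi>_def)
  qed
  have "group_hom (G\<lparr>carrier := B\<rparr>) (BijGroup (rcosets P)) \<phi>"
  proof (rule group_hom.intro)
    show "group (G\<lparr>carrier := B\<rparr>)" using B by (rule subgroup_imp_group)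
    show "group (BijGroup (rcosets P))" by (rule group_BijGroup)
    show "group_hom_axioms (G\<lparr>carrier := B\<rparr>) (BijGroup (rcosets P)) \<phi>"
      unfolding group_hom_axioms_def hom_def BijGroup_def
      using bij comp BG by auto
  qed
  thus ?thesis unfolding group_action_def \<phi>_def .
qed

lemma fixed_rcoset_iff:
  assumes P: "subgroup P G" and B: "subgroup B G" and g: "g \<in> carrier G"
  shows "(\<forall>b\<in>B. (P #> g) #> inv b = P #> g) \<longleftrightarrow> (\<forall>b\<in>B. g \<otimes> b \<otimes> inv g \<in> P)"
proof -
  have PG: "P \<subseteq> carrier G" and BG: "B \<subseteq> carrier G"
    using P B subgroup.subset by auto
  have one: "(P #> g) #> inv b = P #> g \<longleftrightarrow> g \<otimes> inv b \<otimes> inv g \<in> P" if b: "b \<in> B" for b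
  proof -
    have bG: "b \<in> carrier G" using b BG by auto
    have "(P #> g) #> inv b = P #> (g \<otimes> inv b)"
      using PG g bG by (simp add: coset_mult_assoc)
    moreover have "P #> (g \<otimes> inv b) = P #> g \<longleftrightarrow> g \<otimes> inv b \<otimes> inv g \<in> P"
    proof
      assume "P #> (g \<otimes> inv b) = P #> g"
      thus "g \<otimes> inv b \<otimes> inv g \<in> P"
        using coset_mult_inv1[of P "g \<otimes> inv b" g] 
        by (metis P PG bG coset_join1 coset_mult_inv2 g inv_closed m_closed subgroup.subset
            coset_mult_assoc coset_mult_one r_inv)
    next
      assume "g \<otimes> inv b \<otimes> inv g \<in> P"
      thus "P #> (g \<otimes> inv b) = P #> g"
        using PG g bG P by (metis coset_join2 coset_mult_inv1 inv_closed m_closed)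
    qed
    ultimately show ?thesis by simp
  qed
  show ?thesis
    using one B by (metis BG inv_inv subgroup.m_inv_closed subsetD)
qed

lemma card_rcosets_nonfixed:
  assumes p: "prime p" and fin: "finite (carrier G)"
    and P: "subgroup P G" and B: "subgroup B G" and cB: "card B = p ^ b"
  shows "p dvd card (rcosets P - {C \<in> rcosets P. \<forall>b\<in>B. C #> inv b = C})"
proof -
  interpret A: group_action "G\<lparr>carrier := B\<rparr>" "rcosets P" "\<lambda>b. \<lambda>C\<in>rcosets P. C #> inv b"
    using P B by (rule rcoset_translation_action)
  have "{C \<in> rcosets P. \<forall>b\<in>B. C #> inv b = C} =
    {C \<in> rcosets P. \<forall>b\<in>carrier (G\<lparr>carrier := B\<rparr>). (\<lambda>C\<in>rcosets P. C #> inv b) C = C}"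
    by auto
  moreover have "finite (rcosets P)" using fin P rcosets_finite
    by (metis finite_UnionD rcosets_part_G)
  ultimately show ?thesis
    using A.prime_dvd_card_nonfixed[OF p, of b] cB by (simp add: order_def)
qed

lemma card_dvd_of_subgroup_subset:
  assumes "subgroup P G" "subgroup U G" "P \<subseteq> U"
  shows "card P dvd card U"
proof -
  interpret U: group "G\<lparr>carrier := U\<rparr>" using assms(2) by (rule subgroup_imp_group)
  have "subgroup P (G\<lparr>carrier := U\<rparr>)" using assms by (simp add: subgroup_incl)
  from U.lagrange[OF this] show ?thesis
    unfolding order_def by (auto intro: dvdI[where k = "card (rcosets\<^bsub>G\<lparr>carrier := U\<rparr>\<^esub> P)"] simp: mult.commute)
qed

text \<open>The number of cosets of \<open>P\<close> is prime to \<open>p\<close>, while the number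
  of those moved by the \<open>p\<close>-group \<open>B\<close> is divisible by \<open>p\<close>.
  Hence \<open>B\<close> fixes some coset \<open>Pg\<close>, and \<open>inv g\<close> is the
  required conjugating element.\<close>

lemma sylow_conj:
  assumes p: "prime p" and fin: "finite (carrier G)"
    and P: "subgroup P G" and ind: "\<not> p dvd card (rcosets P)"
    and B: "subgroup B G" and cB: "card B = p ^ b"
  shows "\<exists>g\<in>carrier G. \<forall>b\<in>B. inv g \<otimes> b \<otimes> g \<in> P"
proof -
  have "{C \<in> rcosets P. \<forall>b\<in>B. C #> inv b = C} \<noteq> {}"
    using card_rcosets_nonfixed[OF p fin P B cB] ind by (metis Diff_empty)
  then obtain g where g: "g \<in> carrier G" "\<forall>b\<in>B. g \<otimes> b \<otimes> inv g \<in> P"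
    using fixed_rcoset_iff[OF P B] unfolding RCOSETS_def by force
  show ?thesis
    by (rule bexI[of _ "inv g"]) (use g in auto)
qed

lemma ex_sylow_subgroup:
  assumes p: "prime p" and fin: "finite (carrier G)"
  shows "\<exists>Q a. subgroup Q G \<and> card Q = p ^ a \<and> \<not> p dvd card (rcosets Q)"
proof -
  have pos: "order G \<noteq> 0" using fin by (auto simp: order_def)
  define a where "a = multiplicity p (order G)"
  obtain m where m: "order G = p ^ a * m" "\<not> p dvd m"
    using multiplicity_decompose'[of "order G" p] pos p
    by (metis a_def not_prime_unit)
  obtain Q where Q: "subgroup Q G" "card Q = p ^ a"
    using sylow_thm[OF p is_group m(1) fin] by auto
  have "card (rcosets Q) * p ^ a = p ^ a * m"
    using lagrange[OF Q(1)] Q(2) m(1) by simp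
  hence "card (rcosets Q) = m" using p by (auto simp: prime_gt_0_nat)
  with Q m(2) show ?thesis by auto
qed

text \<open>Right translation by \<open>P\<close> fixes exactly the cosets in the normalizer of \<open>P\<close>; as their number
  is divisible by \<open>p\<close>, a Sylow subgroup of the normalizer is larger than \<open>P\<close>.\<close>

lemma p_subgroup_normalizer_grows:
  assumes p: "prime p" and fin: "finite (carrier G)"
    and P: "subgroup P G" and cP: "card P = p ^ a" and ind: "p dvd card (rcosets P)"
  shows "\<exists>Q c. subgroup Q G \<and> card Q = p ^ c \<and> P \<subset> Q \<and> (\<forall>x\<in>Q. \<forall>y\<in>P. inv x \<otimes> y \<otimes> x \<in> P)"
proof -
  have PG: "P \<subseteq> carrier G" using P subgroup.subset by auto
  have finP: "finite P" using PG fin finite_subset by auto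
  define N where "N = {g \<in> carrier G. \<forall>y\<in>P. g \<otimes> y \<otimes> inv g \<in> P}"
  have inN: "inv g \<otimes> y \<otimes> g \<in> P" if gN: "g \<in> N" and y: "y \<in> P" for g y
  proof -
    have g: "g \<in> carrier G" using gN N_def by auto
    \<comment> \<open>Conjugation by \<open>g\<close> is an injective map of the finite set
      \<open>P\<close> into itself, hence onto, so conjugation by \<open>g^-1\<close> preserves
      \<open>P\<close> too.\<close>
    have "inj_on (\<lambda>y. g \<otimes> y \<otimes> inv g) P"
      by (rule inj_onI) (use g PG in \<open>simp add: subset_iff\<close>)
    moreover have "(\<lambda>y. g \<otimes> y \<otimes> inv g) ` P \<subseteq> P" using gN N_def by auto
    ultimately have "(\<lambda>y. g \<otimes> y \<otimes> inv g) ` P = P"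
      using finP by (simp add: endo_inj_surj)
    then obtain z where z: "z \<in> P" "y = g \<otimes> z \<otimes> inv g" using y by auto
    have "inv g \<otimes> y \<otimes> g = z"
      using z g PG by (auto simp: m_assoc[symmetric] dest!: subsetD) (simp add: m_assoc)
    thus ?thesis using z by simp
  qed
  have N: "subgroup N G"
  proof (rule subgroupI)
    show "N \<subseteq> carrier G" by (auto simp: N_def)
    show "N \<noteq> {}" using PG by (force simp: N_def)
    show "inv a \<in> N" if "a \<in> N" for a
      using that inN by (auto simp: N_def)
    show "a \<otimes> b \<in> N" if "a \<in> N" "b \<in> N" for a b
    proof -
      have "a \<otimes> b \<otimes> y \<otimes> inv (a \<otimes> b) = a \<otimes> (b \<otimes> y \<otimes> inv b) \<otimes> inv a" if "y \<in> P" for y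
        using \<open>a \<in> N\<close> \<open>b \<in> N\<close> that PG by (auto simp: N_def inv_mult_group m_assoc dest!: subsetD)
      thus ?thesis using that by (auto simp: N_def)
    qed
  qed
  have PN: "P \<subseteq> N"
    using P PG by (auto simp: N_def subgroup.m_closed subgroup.m_inv_closed)
  let ?N = "G\<lparr>carrier := N\<rparr>"
  interpret N: group ?N using N by (rule subgroup_imp_group)
  have PsN: "subgroup P ?N" using P N PN by (simp add: subgroup_incl)
  have finN: "finite (carrier ?N)" using fin N_def by simp
  have "{C \<in> rcosets P. \<forall>b\<in>P. C #> inv b = C} = rcosets\<^bsub>?N\<^esub> P"
  proof -
    have "rcosets\<^bsub>?N\<^esub> P = (\<lambda>g. P #> g) ` N"
      unfolding RCOSETS_def by (auto simp: r_coset_def)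
    moreover have "rcosets P = (\<lambda>g. P #> g) ` carrier G"
      unfolding RCOSETS_def by auto
    moreover have "(\<forall>b\<in>P. (P #> g) #> inv b = P #> g) \<longleftrightarrow> g \<in> N" if "g \<in> carrier G" for g
      using fixed_rcoset_iff[OF P P that] that unfolding N_def by simp
    moreover have "{C \<in> f ` X. Q C} = f ` Y" if "\<And>x. x \<in> X \<Longrightarrow> Q (f x) \<longleftrightarrow> x \<in> Y" "Y \<subseteq> X"
      for f :: "'a \<Rightarrow> 'a set" and X Y Q using that by blast
    moreover have "N \<subseteq> carrier G" by (auto simp: N_def)
    ultimately show ?thesis by simp
  qed
  moreover have "finite (rcosets P)" using fin P
    by (metis finite_UnionD rcosets_part_G)
  moreover have "card X = card F + card (X - F)" if "finite X" "F \<subseteq> X" for X F :: "'a set set"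
    using that by (metis card_Diff_subset card_mono finite_subset le_add_diff_inverse)
  ultimately have "card (rcosets P) = card (rcosets\<^bsub>?N\<^esub> P) + card (rcosets P - {C \<in> rcosets P. \<forall>b\<in>P. C #> inv b = C})"
    by (metis (no_types, lifting) mem_Collect_eq subsetI)
  with ind have "p dvd card (rcosets\<^bsub>?N\<^esub> P) + card (rcosets P - {C \<in> rcosets P. \<forall>b\<in>P. C #> inv b = C})"
    by argo
  \<comment> \<open>The cosets fixed by \<open>P\<close> are those inside \<open>N\<close>; the
    remaining ones contribute a multiple of \<open>p\<close>, so \<open>p\<close> divides the index
    of \<open>P\<close> in \<open>N\<close>.\<close>
  hence indN: "p dvd card (rcosets\<^bsub>?N\<^esub> P)"
    unfolding dvd_add_left_iff[OF card_rcosets_nonfixed[OF p fin P P cP]] .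
  obtain Q c where Q: "subgroup Q ?N" "card Q = p ^ c" "\<not> p dvd card (rcosets\<^bsub>?N\<^esub> Q)"
    using N.ex_sylow_subgroup[OF p finN] by auto
  obtain g where g: "g \<in> N" "\<forall>b\<in>P. inv g \<otimes> b \<otimes> g \<in> Q"
    using N.sylow_conj[OF p finN Q(1,3) PsN cP] N by (auto simp: m_inv_consistent)
  \<comment> \<open>Sylow's theorem only conjugates \<open>P\<close> into \<open>Q\<close>. The
    conjugating element lies in \<open>N\<close> and so preserves \<open>P\<close>, whence
    \<open>Q\<close> contains \<open>P\<close> itself.\<close>
  have PQ: "P \<subseteq> Q"
  proof
    fix y assume y: "y \<in> P"
    have gG: "g \<in> carrier G" and yG: "y \<in> carrier G" using g y PG N_def by auto
    have "g \<otimes> y \<otimes> inv g \<in> P" using g y N_def by auto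
    hence "inv g \<otimes> (g \<otimes> y \<otimes> inv g) \<otimes> g \<in> Q" using g by auto
    moreover have "inv g \<otimes> (g \<otimes> y \<otimes> inv g) \<otimes> g = y"
      using gG yG by (simp add: m_assoc[symmetric]) (simp add: m_assoc)
    ultimately show "y \<in> Q" by simp
  qed
  have "P \<noteq> Q" using Q(3) indN by auto
  moreover have "subgroup Q G" using Q(1) N incl_subgroup by auto
  moreover have "Q \<subseteq> N" using Q(1) subgroup.subset by force
  ultimately show ?thesis using PQ Q(2) inN by blast
qed

text \<open>The condition on powers makes the quotient by \<open>K\<close> a \<open>p\<close>-group.
  If \<open>KP\<close> were proper, a prime \<open>q\<close> dividing its index would differ from
  \<open>p\<close>. A Sylow \<open>q\<close>-subgroup would then lie in \<open>K\<close>, so its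
  order would divide that of \<open>KP\<close>, which makes its own index divisible by
  \<open>q\<close>.\<close>

lemma sylow_times_normal:
  assumes p: "prime p" and fin: "finite (carrier G)"
    and P: "subgroup P G" and ind: "\<not> p dvd card (rcosets P)"
    and K: "K \<lhd> G" and pow: "\<And>h. h \<in> carrier G \<Longrightarrow> h [^] (p ^ k :: nat) \<in> K"
  shows "carrier G = K <#> P"
proof -
  interpret K: normal K G by (rule K)
  define U where "U = K <#> P"
  have U: "subgroup U G" unfolding U_def using K P by (rule mult_norm_subgroup)
  have KU: "K \<subseteq> U"
  proof
    fix x assume "x \<in> K"
    hence "x \<otimes> \<one> \<in> K <#> P"
      using subgroup.one_closed[OF P] unfolding set_mult_def by blast
    thus "x \<in> U" using \<open>x \<in> K\<close> by (simp add: U_def)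
  qed
  have PU: "P \<subseteq> U"
  proof
    fix x assume x: "x \<in> P"
    hence "\<one> \<otimes> x \<in> K <#> P"
      using subgroup.one_closed[OF K.subgroup_axioms] unfolding set_mult_def by blast
    thus "x \<in> U" using x P subgroup.subset by (fastforce simp: U_def)
  qed
  have finU: "finite U" using U fin subgroup.subset finite_subset by metis
  have "card (rcosets U) = 1"
  proof (rule ccontr)
    assume "card (rcosets U) \<noteq> 1"
    then obtain q where q: "prime q" "q dvd card (rcosets U)"
      using prime_factor_nat by blast
    have "card P dvd card U" using card_dvd_of_subgroup_subset[OF P U PU] .
    then obtain e where e: "card U = card P * e" by auto
    have cP0: "card P \<noteq> 0"
      using subgroup.one_closed[OF P] finite_subset[OF PU finU] by auto
    have "card (rcosets P) * card P = card (rcosets U) * card U"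
      using lagrange[OF P] lagrange[OF U] by simp
    hence "card (rcosets P) = card (rcosets U) * e" using cP0 e by simp
    hence "q \<noteq> p" using q ind by auto
    obtain Q c where Q: "subgroup Q G" "card Q = q ^ c" "\<not> q dvd card (rcosets Q)"
      using ex_sylow_subgroup[OF q(1) fin] by auto
    have QK: "Q \<subseteq> K"
    proof
      fix x assume x: "x \<in> Q"
      interpret Q: group "G\<lparr>carrier := Q\<rparr>" using Q(1) by (rule subgroup_imp_group)
      have xG: "x \<in> carrier G" using x Q(1) subgroup.subset by fastforce
      have "x [^] (q ^ c) = \<one>"
        using Q.pow_order_eq_1[of x] x Q(2) by (simp add: order_def nat_pow_consistent[symmetric])
      hence "x [^] (int (q ^ c)) = \<one>" by (simp only: int_pow_int)
      have "coprime (p ^ k) (q ^ c)"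
        using p q(1) \<open>q \<noteq> p\<close> by (simp add: primes_coprime)
      hence "coprime (int (p ^ k)) (int (q ^ c))" by (simp only: coprime_int_iff)
      then obtain u v where uv: "u * int (p ^ k) + v * int (q ^ c) = 1"
        by (metis bezout_int coprime_imp_gcd_eq_1)
      \<comment> \<open>Bezout splits \<open>x\<close> into a power of \<open>x^(p^k)\<close>, which
        lies in \<open>K\<close>, and a power of \<open>x^(q^c)\<close>, which is trivial.\<close>
      have "x = x [^] (u * int (p ^ k) + v * int (q ^ c))" 
        unfolding uv using xG by (simp add: int_pow_1)
      also have "\<dots> = (x [^] int (p ^ k)) [^] u \<otimes> (x [^] int (q ^ c)) [^] v"
        using xG by (simp add: int_pow_mult int_pow_pow mult.commute)
      also have "\<dots> = (x [^] (p ^ k)) [^] u"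
        using \<open>x [^] (int (q ^ c)) = \<one>\<close> xG by (simp only: int_pow_int int_pow_one) simp
      also have "\<dots> \<in> K" using pow[OF xG] K.subgroup_axioms
        by (simp add: subgroup_int_pow_closed)
      finally show "x \<in> K" .
    qed
    have QU: "Q \<subseteq> U" using QK KU by auto
    have "card Q dvd card U" using card_dvd_of_subgroup_subset[OF Q(1) U QU] .
    then obtain e' where e': "card U = card Q * e'" by auto
    have cQ0: "card Q \<noteq> 0" using Q(2) q(1) by auto
    have "card (rcosets Q) * card Q = card (rcosets U) * card U"
      using lagrange[OF Q(1)] lagrange[OF U] by simp
    hence "card (rcosets Q) = card (rcosets U) * e'" using cQ0 e' by simp
    thus False using Q(3) q(2) by auto
  qed
  hence "card U = card (carrier G)"
    using lagrange[OF U] by (simp add: order_def)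
  moreover have "U \<subseteq> carrier G" using U subgroup.subset by auto
  ultimately have "U = carrier G" using fin card_subset_eq by blast
  thus ?thesis by (simp add: U_def)
qed

end

section \<open>Partial groups\<close>

lemma word_inv_simps [simp]:
  "word_inv L [] = []"
  "word_inv L (a # w) = word_inv L w @ [winv L a]"
  "word_inv L (u @ v) = word_inv L v @ word_inv L u"
  by (simp_all add: word_inv_def)

text \<open>Turns a subgroup of the partial group into a group with binary multiplication, so that
  the Sylow results above apply to it.\<close>

definition group_of :: "('a, 'b) partial_group_scheme \<Rightarrow> 'a set \<Rightarrow> 'a monoid" where
  "group_of L H = \<lparr>carrier = H, mult = (\<lambda>x y. wprod L [x, y]), one = wprod L []\<rparr>"

lemma group_of_simps [simp]:
  "carrier (group_of L H) = H"
  "x \<otimes>\<^bsub>group_of L H\<^esub> y = wprod L [x, y]"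
  "\<one>\<^bsub>group_of L H\<^esub> = wprod L []"
  by (simp_all add: group_of_def)

context partial_group begin

abbreviation pmult (infixl "\<cdot>" 70) where "x \<cdot> y \<equiv> wprod L [x, y]"
abbreviation punit ("\<e>") where "\<e> \<equiv> wprod L []"
abbreviation pinv where "pinv x \<equiv> winv L x"
abbreviation pconj (infixl "\<up>" 75) where "x \<up> g \<equiv> conj_elt L x g"

lemma pinv_closed [simp]: "f \<in> carrier L \<Longrightarrow> pinv f \<in> carrier L"
  using winv_bij by (auto simp: bij_betw_def)

lemma wdom_carrier: "w \<in> wdom L \<Longrightarrow> x \<in> set w \<Longrightarrow> x \<in> carrier L"
  using wdom_words by auto

lemma append_wdomD1: "u @ v \<in> wdom L \<Longrightarrow> u \<in> wdom L"
  and append_wdomD2: "u @ v \<in> wdom L \<Longrightarrow> v \<in> wdom L"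
  using append_wdom[of u v] by simp_all

lemma nil_wdom [simp]: "[] \<in> wdom L"
proof -
  obtain x where "x \<in> carrier L" using carrier_nonempty by auto
  hence "[] @ [x] \<in> wdom L" using singleton_wdom by simp
  thus ?thesis by (rule append_wdomD1)
qed

lemma punit_closed [simp]: "\<e> \<in> carrier L"
  by (simp add: wprod_closed)

lemma assoc_wdom: "u @ v @ w \<in> wdom L \<Longrightarrow> u @ [wprod L v] @ w \<in> wdom L"
  and assoc_wprod: "u @ v @ w \<in> wdom L \<Longrightarrow> wprod L (u @ [wprod L v] @ w) = wprod L (u @ v @ w)"
  using wprod_assoc[of u v w] by simp_all

lemma wprod_append:
  assumes "u @ v \<in> wdom L"
  shows "[wprod L u, wprod L v] \<in> wdom L" "wprod L (u @ v) = wprod L u \<cdot> wprod L v"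
proof -
  have "[wprod L u] @ v @ [] \<in> wdom L" "wprod L ([wprod L u] @ v @ []) = wprod L (u @ v)"
    using assoc_wdom[of "[]" u v] assoc_wprod[of "[]" u v] assms by auto
  thus "[wprod L u, wprod L v] \<in> wdom L" "wprod L (u @ v) = wprod L u \<cdot> wprod L v"
    using assoc_wdom[of "[wprod L u]" v "[]"] assoc_wprod[of "[wprod L u]" v "[]"] by auto
qed

text \<open>Generalized associativity: the blocks are contracted one after the other from the left.
  The induction carries a prefix \<open>u\<close> for the blocks already contracted. Most
  rebracketings below are instances of it.\<close>

lemma wprod_concat:
  assumes "concat ws \<in> wdom L"
  shows "map (wprod L) ws \<in> wdom L" "wprod L (map (wprod L) ws) = wprod L (concat ws)"
proof -
  have "u @ map (wprod L) ws \<in> wdom L \<and> wprod L (u @ map (wprod L) ws) = wprod L (u @ concat ws)"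
    if "u @ concat ws \<in> wdom L" for u
    using that
  proof (induction ws arbitrary: u)
    case (Cons w ws)
    have "u @ w @ concat ws \<in> wdom L" using Cons.prems by simp
    from assoc_wdom[OF this] assoc_wprod[OF this] Cons.IH[of "u @ [wprod L w]"]
    show ?case by simp
  qed simp
  from this[of "[]"] assms
  show "map (wprod L) ws \<in> wdom L" "wprod L (map (wprod L) ws) = wprod L (concat ws)" by auto
qed

lemma punit_mult [simp]:
  assumes "x \<in> carrier L"
  shows "\<e> \<cdot> x = x" "x \<cdot> \<e> = x" "[\<e>, x] \<in> wdom L" "[x, \<e>] \<in> wdom L"
  using wprod_append[of "[]" "[x]"] wprod_append[of "[x]" "[]"] assms
  by (simp_all add: singleton_wdom wprod_singleton)

lemma word_inv_word_inv: "w \<in> lists (carrier L) \<Longrightarrow> word_inv L (word_inv L w) = w"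
  by (induction w) (auto simp: winv_winv)

lemma word_inv_wdom: "w \<in> wdom L \<Longrightarrow> word_inv L w \<in> wdom L"
  using append_wdomD1[of "word_inv L w" w] wprod_inv[of w] by simp

lemma wprod_inv_right:
  assumes "w \<in> wdom L"
  shows "w @ word_inv L w \<in> wdom L" "wprod L (w @ word_inv L w) = \<e>"
  using wprod_inv[OF word_inv_wdom[OF assms]] word_inv_word_inv[OF subsetD[OF wdom_words assms]]
  by simp_all

text \<open>The inversion axiom puts \<open>v^-1 u^-1 u v\<close> into the domain, and the required
  word is a suffix of it.\<close>

lemma cancel_left:
  assumes "u @ v \<in> wdom L"
  shows "word_inv L u @ u @ v \<in> wdom L" "wprod L (word_inv L u @ u @ v) = wprod L v"
proof -
  have "word_inv L v @ word_inv L u @ u @ v \<in> wdom L"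
    using wprod_inv[OF assms] by simp
  thus 1: "word_inv L u @ u @ v \<in> wdom L" by (rule append_wdomD2)
  have "wprod L ((word_inv L u @ u) @ v) = wprod L (word_inv L u @ u) \<cdot> wprod L v"
    using wprod_append(2)[of "word_inv L u @ u" v] 1 by simp
  also have "\<dots> = wprod L v"
    using wprod_inv[of u] append_wdomD1[OF assms] append_wdomD2[OF assms] by (simp add: wprod_closed)
  finally show "wprod L (word_inv L u @ u @ v) = wprod L v" by simp
qed

lemma cancel_right:
  assumes "u @ v \<in> wdom L"
  shows "u @ v @ word_inv L v \<in> wdom L" "wprod L (u @ v @ word_inv L v) = wprod L u"
proof -
  have "(u @ v @ word_inv L v) @ word_inv L u \<in> wdom L"
    using wprod_inv_right[OF assms] by simp
  thus 1: "u @ v @ word_inv L v \<in> wdom L" by (rule append_wdomD1)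
  have "wprod L (u @ v @ word_inv L v) = wprod L u \<cdot> wprod L (v @ word_inv L v)"
    using wprod_append(2)[of u "v @ word_inv L v"] 1 by simp
  also have "\<dots> = wprod L u"
    using wprod_inv_right[of v] append_wdomD1[OF assms] append_wdomD2[OF assms]
    by (simp add: wprod_closed)
  finally show "wprod L (u @ v @ word_inv L v) = wprod L u" .
qed

lemma pinv_wdom [simp]:
  assumes "x \<in> carrier L"
  shows "[pinv x, x] \<in> wdom L" "pinv x \<cdot> x = \<e>" "[x, pinv x] \<in> wdom L" "x \<cdot> pinv x = \<e>"
  using wprod_inv[of "[x]"] wprod_inv_right[of "[x]"] singleton_wdom[OF assms] by auto

lemma pinv_unique:
  assumes "[a, b] \<in> wdom L" "a \<cdot> b = \<e>"
  shows "a = pinv b"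
proof -
  have ab: "a \<in> carrier L" "b \<in> carrier L" using assms(1) wdom_carrier by auto
  have "[] @ [a, b] @ [pinv b] \<in> wdom L" "wprod L [a, b, pinv b] = a"
    using cancel_right[of "[a]" "[b]"] assms(1) ab by (auto simp: wprod_singleton)
  moreover have "wprod L ([] @ [a, b] @ [pinv b]) = wprod L ([] @ [a \<cdot> b] @ [pinv b])"
    using assoc_wprod[OF calculation(1)] by simp
  ultimately show ?thesis using assms(2) ab by simp
qed

lemma wprod_word_inv:
  assumes "w \<in> wdom L"
  shows "wprod L (word_inv L w) = pinv (wprod L w)"
  using wprod_append[of "word_inv L w" w] wprod_inv[OF assms] pinv_unique by simp

lemma pinv_punit [simp]: "pinv \<e> = \<e>"
  using wprod_word_inv[of "[]"] by simp

lemma pinv_mult: "[a, b] \<in> wdom L \<Longrightarrow> pinv (a \<cdot> b) = pinv b \<cdot> pinv a"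
  using wprod_word_inv[of "[a, b]"] by simp

section \<open>Conjugation\<close>

lemma conj_domD:
  assumes "x \<in> conj_dom L g"
  shows "x \<in> carrier L" "g \<in> carrier L" "[pinv g, x, g] \<in> wdom L" "x \<up> g \<in> carrier L"
  using assms wdom_carrier[of "[pinv g, x, g]" g] by (auto simp: conj_dom_def conj_elt_def wprod_closed)

lemma conj_domI: "[pinv g, x, g] \<in> wdom L \<Longrightarrow> x \<in> conj_dom L g"
  using wdom_carrier[of "[pinv g, x, g]" x] by (simp add: conj_dom_def)

text \<open>Cancelling pairs attached on both sides give the word
  \<open>(g, g^-1, x, g, g^-1)\<close>. Contracting its middle yields the conjugate of
  \<open>x \<up> g\<close> by \<open>g^-1\<close>; cancelling yields \<open>x\<close>.\<close>

lemma conj_pinv: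
  assumes "x \<in> conj_dom L g"
  shows "x \<up> g \<in> conj_dom L (pinv g)" "x \<up> g \<up> pinv g = x"
proof -
  note D = conj_domD[OF assms]
  have 1: "[g, pinv g, x, g] \<in> wdom L"
    using cancel_left(1)[of "[pinv g]" "[x, g]"] D by (simp add: winv_winv)
  have 2: "[g] @ [pinv g, x, g] @ [pinv g] \<in> wdom L"
    using cancel_right(1)[of "[g, pinv g, x]" "[g]"] 1 by simp
  show "x \<up> g \<in> conj_dom L (pinv g)"
    using assoc_wdom[OF 2] D by (auto intro: conj_domI simp: winv_winv conj_elt_def)
  have "x \<up> g \<up> pinv g = wprod L [g, pinv g, x, g, pinv g]"
    using assoc_wprod[OF 2] D by (simp add: winv_winv conj_elt_def)
  also have "\<dots> = wprod L [g, pinv g, x]"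
    using cancel_right(2)[of "[g, pinv g, x]" "[g]"] 1 by simp
  also have "\<dots> = x"
    using cancel_left(2)[of "[pinv g]" "[x]"] append_wdomD1[of "[pinv g, x]" "[g]"] D
    by (simp add: winv_winv wprod_singleton)
  finally show "x \<up> g \<up> pinv g = x" .
qed

lemma conj_pinv':
  assumes "x \<in> conj_dom L (pinv g)" "g \<in> carrier L"
  shows "x \<up> pinv g \<in> conj_dom L g" "x \<up> pinv g \<up> g = x"
  using conj_pinv[OF assms(1)] winv_winv[OF assms(2)] by simp_all

lemma conj_elt_eq:
  assumes "[pinv g, x, g] \<in> wdom L"
  shows "x \<up> g = pinv g \<cdot> x \<cdot> g"
  using assoc_wprod[of "[]" "[pinv g, x]" "[g]"] assms by (simp add: conj_elt_def)

lemma inj_on_conj: "X \<subseteq> conj_dom L g \<Longrightarrow> inj_on (\<lambda>x. x \<up> g) X"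
  using conj_pinv(2)[of _ g] by (intro inj_on_inverseI[of _ "\<lambda>x. x \<up> pinv g"]) auto

lemma card_conj_set: "X \<subseteq> conj_dom L g \<Longrightarrow> card (conj_set L X g) = card X"
  using card_image[OF inj_on_conj] unfolding conj_set_def by blast

text \<open>In \<open>w^-1 x w\<close> the outer blocks contract to the inverse of the product of
  \<open>w\<close> and to that product.\<close>

lemma conj_wprod:
  assumes "word_inv L w @ [x] @ w \<in> wdom L"
  shows "x \<in> conj_dom L (wprod L w)" "x \<up> wprod L w = wprod L (word_inv L w @ [x] @ w)"
proof -
  have w: "w \<in> wdom L" using append_wdomD2[of "word_inv L w @ [x]" w] assms by simp
  have 1: "[] @ [wprod L (word_inv L w)] @ ([x] @ w) \<in> wdom L"
    "wprod L ([wprod L (word_inv L w)] @ ([x] @ w)) = wprod L (word_inv L w @ [x] @ w)"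
    using assoc_wdom[of "[]" "word_inv L w" "[x] @ w"] assoc_wprod[of "[]" "word_inv L w" "[x] @ w"] assms
    by auto
  have 2: "[wprod L (word_inv L w), x] @ [wprod L w] @ [] \<in> wdom L"
    "wprod L ([wprod L (word_inv L w), x] @ [wprod L w] @ []) = wprod L (word_inv L w @ [x] @ w)"
    using assoc_wdom[of "[wprod L (word_inv L w), x]" w "[]"]
      assoc_wprod[of "[wprod L (word_inv L w), x]" w "[]"] 1 by auto
  show "x \<in> conj_dom L (wprod L w)" "x \<up> wprod L w = wprod L (word_inv L w @ [x] @ w)"
    using 2 wprod_word_inv[OF w] by (auto intro: conj_domI simp: conj_elt_def)
qed

lemma conj_word_foldl:
  assumes "word_inv L w @ [x] @ w \<in> wdom L"
  shows "wprod L (word_inv L w @ [x] @ w) = foldl (conj_elt L) x w"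
  using assms
proof (induction w arbitrary: x)
  case Nil
  then show ?case using wdom_carrier[of "[x]" x] by (simp add: wprod_singleton)
next
  case (Cons g w)
  have "word_inv L w @ [pinv g, x, g] @ w \<in> wdom L" using Cons.prems by simp
  from assoc_wdom[OF this] assoc_wprod[OF this] Cons.IH[of "x \<up> g"]
  show ?case by (simp add: conj_elt_def)
qed

text \<open>The inner pair \<open>g g^-1\<close> contracts to the unit, leaving
  \<open>(g^-1, x, y, g)\<close>; contracting the two halves instead gives the product of the
  conjugates.\<close>

lemma conj_mult:
  assumes "[pinv g, x, g, pinv g, y, g] \<in> wdom L"
  shows "[x, y] \<in> wdom L" "x \<cdot> y \<in> conj_dom L g" "[x \<up> g, y \<up> g] \<in> wdom L"
    "(x \<cdot> y) \<up> g = (x \<up> g) \<cdot> (y \<up> g)"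
proof -
  have g: "g \<in> carrier L" "x \<in> carrier L" "y \<in> carrier L" using wdom_carrier[OF assms] by auto
  have "[pinv g, x] @ [g, pinv g] @ [y, g] \<in> wdom L" using assms by simp
  from assoc_wdom[OF this] assoc_wprod[OF this] g
  have 1: "[pinv g, x] @ [\<e>, y] @ [g] \<in> wdom L"
    "wprod L ([pinv g, x] @ [\<e>, y] @ [g]) = wprod L [pinv g, x, g, pinv g, y, g]" by auto
  from assoc_wdom[OF 1(1)] assoc_wprod[OF 1(1)] g
  have 2: "[pinv g] @ [x, y] @ [g] \<in> wdom L"
    "wprod L ([pinv g] @ [x, y] @ [g]) = wprod L [pinv g, x, g, pinv g, y, g]" using 1 by auto
  show "[x, y] \<in> wdom L"
    using append_wdomD1[OF append_wdomD2[OF 2(1)]] .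
  from assoc_wdom[OF 2(1)] assoc_wprod[OF 2(1)]
  have 3: "[pinv g, x \<cdot> y, g] \<in> wdom L" "wprod L [pinv g, x \<cdot> y, g] = wprod L [pinv g, x, g, pinv g, y, g]"
    using 2 by auto
  thus "x \<cdot> y \<in> conj_dom L g" by (auto intro: conj_domI)
  from wprod_append[of "[pinv g, x, g]" "[pinv g, y, g]"] assms
  show "[x \<up> g, y \<up> g] \<in> wdom L" "(x \<cdot> y) \<up> g = (x \<up> g) \<cdot> (y \<up> g)"
    using 3 by (simp_all add: conj_elt_def)
qed

lemma conj_dom_pinv:
  assumes "x \<in> conj_dom L g"
  shows "pinv x \<in> conj_dom L g" "pinv x \<up> g = pinv (x \<up> g)"
  using word_inv_wdom[OF conj_domD(3)[OF assms]] wprod_word_inv[OF conj_domD(3)[OF assms]]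
    conj_domD(2)[OF assms]
  by (auto intro: conj_domI simp: winv_winv conj_elt_def)

lemma conj_punit [simp]:
  assumes "x \<in> carrier L"
  shows "x \<in> conj_dom L \<e>" "x \<up> \<e> = x"
proof -
  have "[] @ [] @ [x, \<e>] \<in> wdom L" using assms by simp
  from assoc_wdom[OF this] assoc_wprod[OF this] assms
  have "[\<e>, x, \<e>] \<in> wdom L" "wprod L [\<e>, x, \<e>] = x" by auto
  thus "x \<in> conj_dom L \<e>" "x \<up> \<e> = x" by (auto intro: conj_domI simp: conj_elt_def)
qed

section \<open>Partial subgroups and the groups they contain\<close>

lemma partial_subgroupI:
  assumes "H \<noteq> {}" "H \<subseteq> carrier L" "\<And>h. h \<in> H \<Longrightarrow> pinv h \<in> H"
    and mult: "\<And>x y. x \<in> H \<Longrightarrow> y \<in> H \<Longrightarrow> [x, y] \<in> wdom L \<Longrightarrow> x \<cdot> y \<in> H"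
  shows "partial_subgroup L H"
proof -
  obtain h where h: "h \<in> H" using assms(1) by auto
  hence "pinv h \<cdot> h \<in> H" using assms by (intro mult) auto
  hence one: "\<e> \<in> H" using h assms(2) by auto
  \<comment> \<open>Closure under binary products extends to words by splitting off the first
    letter.\<close>
  have "wprod L v \<in> H" if "v \<in> lists H" "v \<in> wdom L" for v
    using that
  proof (induction v rule: list.induct)
    case (Cons x v)
    have x: "x \<in> H" "x \<in> carrier L" and "v \<in> lists H" using Cons.prems(1) assms(2) by auto
    hence "wprod L v \<in> H" using Cons.IH append_wdomD2[of "[x]" v] Cons.prems(2) by simp
    moreover have "[x, wprod L v] \<in> wdom L" "wprod L (x # v) = x \<cdot> wprod L v"
      using wprod_append[of "[x]" v] Cons.prems(2) x by (simp_all add: wprod_singleton)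
    ultimately show ?case using mult x by simp
  qed (use one in auto)
  thus ?thesis using assms by (auto simp: partial_subgroup_def)
qed

lemma partial_subgroupD:
  assumes "partial_subgroup L H"
  shows "H \<subseteq> carrier L" "x \<in> H \<Longrightarrow> pinv x \<in> H"
    "v \<in> lists H \<Longrightarrow> v \<in> wdom L \<Longrightarrow> wprod L v \<in> H" "\<e> \<in> H"
    "x \<in> H \<Longrightarrow> y \<in> H \<Longrightarrow> [x, y] \<in> wdom L \<Longrightarrow> x \<cdot> y \<in> H"
proof -
  show p: "v \<in> lists H \<Longrightarrow> v \<in> wdom L \<Longrightarrow> wprod L v \<in> H" for v
    using assms by (auto simp: partial_subgroup_def)
  show "\<e> \<in> H" using p[of "[]"] by simp
  show "x \<in> H \<Longrightarrow> y \<in> H \<Longrightarrow> [x, y] \<in> wdom L \<Longrightarrow> x \<cdot> y \<in> H" using p[of "[x, y]"] by simp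
qed (use assms in \<open>auto simp: partial_subgroup_def\<close>)

lemma partial_subgroup_conj:
  "partial_subgroup L H \<Longrightarrow> x \<in> H \<Longrightarrow> g \<in> H \<Longrightarrow> x \<in> conj_dom L g \<Longrightarrow> x \<up> g \<in> H"
  using partial_subgroupD(2)[of H g] partial_subgroupD(3)[of H "[pinv g, x, g]"] conj_domD(3)[of x g]
  by (simp add: conj_elt_def)

lemma partial_subgroup_Int:
  assumes H: "partial_subgroup L H" and K: "partial_subgroup L K"
  shows "partial_subgroup L (H \<inter> K)"
proof (rule partial_subgroupI)
  show "H \<inter> K \<noteq> {}" using partial_subgroupD(4)[OF H] partial_subgroupD(4)[OF K] by auto
qed (use partial_subgroupD(1,2,5)[OF H] partial_subgroupD(1,2,5)[OF K] in auto)

lemma partial_subgroup_carrier: "partial_subgroup L (carrier L)"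
  using carrier_nonempty by (intro partial_subgroupI) (auto simp: wprod_closed)

lemma pg_subgroupD:
  assumes "pg_subgroup L H"
  shows "partial_subgroup L H" "w \<in> lists H \<Longrightarrow> w \<in> wdom L" "H \<subseteq> carrier L"
    "x \<in> H \<Longrightarrow> pinv x \<in> H" "\<e> \<in> H" "x \<in> H \<Longrightarrow> y \<in> H \<Longrightarrow> x \<cdot> y \<in> H"
proof -
  show H: "partial_subgroup L H" and w: "\<And>w. w \<in> lists H \<Longrightarrow> w \<in> wdom L"
    using assms by (auto simp: pg_subgroup_def)
  show "H \<subseteq> carrier L" "\<e> \<in> H" "x \<in> H \<Longrightarrow> pinv x \<in> H"
    using partial_subgroupD[OF H] by auto
  show "x \<in> H \<Longrightarrow> y \<in> H \<Longrightarrow> x \<cdot> y \<in> H"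
    using partial_subgroupD(5)[OF H] w[of "[x, y]"] by simp
qed

lemma pg_subgroup_subset:
  "pg_subgroup L H \<Longrightarrow> partial_subgroup L K \<Longrightarrow> K \<subseteq> H \<Longrightarrow> pg_subgroup L K"
  unfolding pg_subgroup_def by (meson lists_mono order_trans)

lemma group_group_of:
  assumes H: "pg_subgroup L H"
  shows "group (group_of L H)"
proof (rule groupI)
  note D = pg_subgroupD[OF H]
  fix x y z assume "x \<in> carrier (group_of L H)" "y \<in> carrier (group_of L H)" "z \<in> carrier (group_of L H)"
  hence xyz: "x \<in> H" "y \<in> H" "z \<in> H" by simp_all
  have w: "[x, y, z] \<in> wdom L" using xyz D by simp
  have "wprod L [x \<cdot> y, z] = wprod L [x, y \<cdot> z]"
    using assoc_wprod[of "[]" "[x, y]" "[z]"] assoc_wprod[of "[x]" "[y, z]" "[]"] w by simp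
  thus "x \<otimes>\<^bsub>group_of L H\<^esub> y \<otimes>\<^bsub>group_of L H\<^esub> z = x \<otimes>\<^bsub>group_of L H\<^esub> (y \<otimes>\<^bsub>group_of L H\<^esub> z)"
    by simp
qed (use pg_subgroupD[OF H] in \<open>auto intro!: bexI[of _ "pinv _"]\<close>)

lemma inv_group_of:
  assumes H: "pg_subgroup L H" and "x \<in> H"
  shows "inv\<^bsub>group_of L H\<^esub> x = pinv x"
  using pg_subgroupD[OF H] assms group.inv_equality[OF group_group_of[OF H], of "pinv x" x] by auto

lemma subgroup_group_of_iff:
  assumes H: "pg_subgroup L H"
  shows "subgroup K (group_of L H) \<longleftrightarrow> pg_subgroup L K \<and> K \<subseteq> H"
proof
  interpret group "group_of L H" using H by (rule group_group_of)
  note D = pg_subgroupD[OF H]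
  show "pg_subgroup L K \<and> K \<subseteq> H" if K: "subgroup K (group_of L H)"
  proof -
    have KH: "K \<subseteq> H" using subgroup.subset[OF K] by simp
    moreover have "partial_subgroup L K"
    proof (rule partial_subgroupI)
      show "pinv h \<in> K" if "h \<in> K" for h
        using subgroup.m_inv_closed[OF K that] inv_group_of[OF H] that KH by auto
      show "x \<cdot> y \<in> K" if "x \<in> K" "y \<in> K" for x y
        using subgroup.m_closed[OF K that] by simp
    qed (use KH D subgroup.one_closed[OF K] in auto)
    ultimately show ?thesis using pg_subgroup_subset[OF H] by auto
  qed
  show "subgroup K (group_of L H)" if "pg_subgroup L K \<and> K \<subseteq> H"
  proof (rule subgroupI)
    show "inv\<^bsub>group_of L H\<^esub> a \<in> K" if "a \<in> K" for a
      using that \<open>pg_subgroup L K \<and> K \<subseteq> H\<close> inv_group_of[OF H, of a] pg_subgroupD(4)[of K a] by auto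
  qed (use that pg_subgroupD[of K] in auto)
qed

lemma partial_normalD:
  assumes "partial_normal_subgroup L N"
  shows "partial_subgroup L N" "x \<in> N \<Longrightarrow> x \<in> conj_dom L f \<Longrightarrow> x \<up> f \<in> N"
  using assms conj_domD(2)[of x f] unfolding partial_normal_subgroup_def by auto

lemma partial_normal_carrier: "partial_normal_subgroup L (carrier L)"
  by (auto simp: partial_normal_subgroup_def partial_subgroup_carrier conj_domD)

lemma partial_normal_Int:
  "partial_normal_subgroup L M \<Longrightarrow> partial_normal_subgroup L N \<Longrightarrow> partial_normal_subgroup L (M \<inter> N)"
  unfolding partial_normal_subgroup_def by (auto intro: partial_subgroup_Int)

end

section \<open>Localities\<close>

text \<open>The chains of objects in axiom (L2), recorded by their first member only, since each
  later member is determined as a conjugate of the previous one.\<close>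

primrec obj_path :: "('a, 'b) partial_group_scheme \<Rightarrow> 'a set set \<Rightarrow> 'a set \<Rightarrow> 'a list \<Rightarrow> bool" where
  "obj_path L D P [] \<longleftrightarrow> P \<in> D"
| "obj_path L D P (g # w) \<longleftrightarrow> P \<in> D \<and> P \<subseteq> conj_dom L g \<and> obj_path L D (conj_set L P g) w"

lemma obj_path_obj: "obj_path L D P w \<Longrightarrow> P \<in> D"
  by (cases w) auto

lemma obj_path_append:
  "obj_path L D P (u @ v) \<longleftrightarrow> obj_path L D P u \<and> obj_path L D (foldl (conj_set L) P u) v"
  by (induction u arbitrary: P) (auto dest: obj_path_obj)

lemma obj_path_iff:
  "obj_path L D P w \<longleftrightarrow>
    (\<exists>Q :: nat \<Rightarrow> 'a set. Q 0 = P \<and> (\<forall>i\<le>length w. Q i \<in> D) \<and>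
      (\<forall>i<length w. Q i \<subseteq> conj_dom L (w ! i) \<and> conj_set L (Q i) (w ! i) = Q (Suc i)))"
proof (induction w arbitrary: P)
  case Nil
  show ?case by (auto intro: exI[of _ "\<lambda>_. P"])
next
  case (Cons g w)
  show ?case
  proof
    assume path: "obj_path L D P (g # w)"
    then obtain Q :: "nat \<Rightarrow> 'a set" where Q: "Q 0 = conj_set L P g" "\<forall>i\<le>length w. Q i \<in> D"
      "\<forall>i<length w. Q i \<subseteq> conj_dom L (w ! i) \<and> conj_set L (Q i) (w ! i) = Q (Suc i)"
      using Cons.IH[of "conj_set L P g"] by auto
    show "\<exists>Q :: nat \<Rightarrow> 'a set. Q 0 = P \<and> (\<forall>i\<le>length (g # w). Q i \<in> D) \<and>
      (\<forall>i<length (g # w). Q i \<subseteq> conj_dom L ((g # w) ! i) \<and> conj_set L (Q i) ((g # w) ! i) = Q (Suc i))"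
      by (rule exI[of _ "case_nat P Q"])
        (use path Q in \<open>auto simp: less_Suc_eq_le[symmetric] All_less_Suc2\<close>)
  next
    assume "\<exists>Q :: nat \<Rightarrow> 'a set. Q 0 = P \<and> (\<forall>i\<le>length (g # w). Q i \<in> D) \<and>
      (\<forall>i<length (g # w). Q i \<subseteq> conj_dom L ((g # w) ! i) \<and> conj_set L (Q i) ((g # w) ! i) = Q (Suc i))"
    then obtain Q :: "nat \<Rightarrow> 'a set" where Q: "Q 0 = P" "\<forall>i<Suc (Suc (length w)). Q i \<in> D"
      "\<forall>i<Suc (length w). Q i \<subseteq> conj_dom L ((g # w) ! i) \<and> conj_set L (Q i) ((g # w) ! i) = Q (Suc i)"
      by (auto simp: less_Suc_eq_le)
    have "obj_path L D (Q 1) w"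
      unfolding Cons.IH
      by (rule exI[of _ "\<lambda>i. Q (Suc i)"])
        (use Q in \<open>auto simp: less_Suc_eq_le[symmetric] All_less_Suc2\<close>)
    thus "obj_path L D P (g # w)" using Q by (auto simp: All_less_Suc2)
  qed
qed

text \<open>Recursive form of \<open>S_word\<close>, suited to induction on words;
  \<open>S_word_eq\<close> shows that the two agree.\<close>

primrec word_conj_set :: "('a, 'b) partial_group_scheme \<Rightarrow> 'a set \<Rightarrow> 'a list \<Rightarrow> 'a set" where
  "word_conj_set L S [] = S"
| "word_conj_set L S (g # w) = {s \<in> S_elt L S g. conj_elt L s g \<in> word_conj_set L S w}"

lemma word_conj_set_append:
  "s \<in> word_conj_set L S (u @ v) \<longleftrightarrow>
    s \<in> word_conj_set L S u \<and> foldl (conj_elt L) s u \<in> word_conj_set L S v"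
proof (induction u arbitrary: s)
  case Nil
  show ?case by (cases v) (auto simp: S_elt_def)
qed auto

lemma word_conj_set_subset: "word_conj_set L S w \<subseteq> S"
  by (cases w) (auto simp: S_elt_def)

lemma foldl_word_conj_set: "s \<in> word_conj_set L S w \<Longrightarrow> foldl (conj_elt L) s w \<in> S"
  by (induction w arbitrary: s) auto

lemma (in partial_group) S_word_eq:
  assumes "S \<subseteq> carrier L"
  shows "S_word L S w = word_conj_set L S w"
proof (rule Set.set_eqI)
  fix s
  show "s \<in> S_word L S w \<longleftrightarrow> s \<in> word_conj_set L S w"
  proof (induction w arbitrary: s)
    case Nil
    show ?case by (auto simp: S_word_def)
  next
    case (Cons g w)
    show ?case
    proof
      assume "s \<in> S_word L S (g # w)"
      then obtain x where x: "\<forall>i<Suc (Suc (length w)). x i \<in> S" "s = x 0"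
        "\<forall>i<Suc (length w). [pinv ((g # w) ! i), x i, (g # w) ! i] \<in> wdom L \<and>
                        x i \<up> ((g # w) ! i) = x (Suc i)"
        by (auto simp: S_word_def less_Suc_eq_le)
      have "x 1 \<in> S_word L S w"
        unfolding S_word_def
        using x by (auto intro!: exI[of _ "\<lambda>i. x (Suc i)"] simp: less_Suc_eq_le[symmetric] All_less_Suc2)
      moreover have "s \<in> S_elt L S g" "s \<up> g = x 1"
        using x assms by (auto simp: S_elt_def conj_dom_def All_less_Suc2)
      ultimately show "s \<in> word_conj_set L S (g # w)" using Cons.IH by auto
    next
      assume s: "s \<in> word_conj_set L S (g # w)"
      hence "s \<up> g \<in> S_word L S w" using Cons.IH by auto
      then obtain x where x: "\<forall>i<Suc (length w). x i \<in> S" "s \<up> g = x 0"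
        "\<forall>i<length w. [pinv (w ! i), x i, w ! i] \<in> wdom L \<and> x i \<up> (w ! i) = x (Suc i)"
        by (auto simp: S_word_def less_Suc_eq_le)
      show "s \<in> S_word L S (g # w)"
        unfolding S_word_def
        using x s by (auto intro!: exI[of _ "case_nat s x"]
            simp: less_Suc_eq_le[symmetric] All_less_Suc2 S_elt_def conj_dom_def)
    qed
  qed
qed

lemma conj_set_mono: "P \<subseteq> Q \<Longrightarrow> conj_set L P g \<subseteq> conj_set L Q g"
  by (auto simp: conj_set_def)

text \<open>The assumed words make conjugation by \<open>g\<close> multiplicative on
  \<open>P\<close>, and the surrounding subgroup \<open>T\<close> ensures that all words in the
  image have products.\<close>

lemma (in partial_group) conj_set_subgroup:
  assumes P: "pg_subgroup L P" and T: "pg_subgroup L T" and PT: "conj_set L P g \<subseteq> T"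
    and PD: "P \<subseteq> conj_dom L g"
    and D: "\<And>x y. x \<in> P \<Longrightarrow> y \<in> P \<Longrightarrow> [pinv g, x, g, pinv g, y, g] \<in> wdom L"
  shows "pg_subgroup L (conj_set L P g)"
proof (rule pg_subgroup_subset[OF T _ PT], rule partial_subgroupI)
  note P' = pg_subgroupD[OF P]
  show "conj_set L P g \<noteq> {}" using P' by (auto simp: conj_set_def)
  show "conj_set L P g \<subseteq> carrier L" using PT pg_subgroupD[OF T] by auto
  show "pinv h \<in> conj_set L P g" if h: "h \<in> conj_set L P g" for h
  proof -
    obtain x where x: "x \<in> P" "h = x \<up> g" using h by (auto simp: conj_set_def)
    hence "pinv h = pinv x \<up> g" using conj_dom_pinv(2)[of x g] PD by auto
    thus ?thesis using x P' by (auto simp: conj_set_def)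
  qed
  show "h \<cdot> k \<in> conj_set L P g" if h: "h \<in> conj_set L P g" "k \<in> conj_set L P g" for h k
  proof -
    obtain x y where x: "x \<in> P" "h = x \<up> g" "y \<in> P" "k = y \<up> g" using h by (auto simp: conj_set_def)
    hence "h \<cdot> k = (x \<cdot> y) \<up> g" using conj_mult(4)[OF D] by auto
    thus ?thesis using x P' by (auto simp: conj_set_def)
  qed
qed

section \<open>The domain of the product in terms of objects\<close>

context locality begin

lemma S_subgroup: "pg_subgroup L S"
  and finite_S: "finite S"
  and card_S: "\<exists>k. card S = p ^ k"
  using S_p_subgroup by (auto simp: pg_p_subgroup_def)

lemmas S_D = pg_subgroupD[OF S_subgroup]

lemma obj_subgroup: "P \<in> \<Delta> \<Longrightarrow> pg_subgroup L P"
  and obj_subset: "P \<in> \<Delta> \<Longrightarrow> P \<subseteq> S"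
  using objects_subgroups by auto

lemma wdom_iff_path: "w \<in> lists (carrier L) \<Longrightarrow> w \<in> wdom L \<longleftrightarrow> (\<exists>P. obj_path L \<Delta> P w)"
  using locality_wdom[of w] unfolding obj_path_iff by blast

text \<open>A letter of a chain automatically lies in the carrier: the object preceding it contains
  the unit and lies in the conjugation domain of the letter.\<close>

lemma obj_path_wdom: "obj_path L \<Delta> P w \<Longrightarrow> w \<in> wdom L"
proof -
  assume path: "obj_path L \<Delta> P w"
  have "x \<in> carrier L" if "x \<in> set w" for x
  proof -
    obtain u v where w: "w = u @ x # v" using \<open>x \<in> set w\<close> by (auto simp: in_set_conv_decomp)
    hence "foldl (conj_set L) P u \<in> \<Delta>" "foldl (conj_set L) P u \<subseteq> conj_dom L x"
      using path by (auto simp: obj_path_append)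
    thus ?thesis using conj_domD(2)[of "\<e>" x] pg_subgroupD(5)[OF obj_subgroup] by auto
  qed
  thus ?thesis using wdom_iff_path path by blast
qed

lemma conj_set_pinv:
  "P \<subseteq> conj_dom L g \<Longrightarrow> conj_set L P g \<subseteq> conj_dom L (pinv g) \<and> conj_set L (conj_set L P g) (pinv g) = P"
  using conj_pinv[of _ g] by (force simp: conj_set_def)

lemma obj_path_rev:
  "obj_path L \<Delta> P w \<Longrightarrow> obj_path L \<Delta> (foldl (conj_set L) P w) (word_inv L w) \<and>
    foldl (conj_set L) (foldl (conj_set L) P w) (word_inv L w) = P"
proof (induction w arbitrary: P)
  case (Cons g w)
  let ?Q = "conj_set L P g"
  have "?Q \<subseteq> conj_dom L (pinv g)" "conj_set L ?Q (pinv g) = P"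
    using conj_set_pinv[of P g] Cons.prems by auto
  thus ?case using Cons.IH[of ?Q] Cons.prems obj_path_obj[of L \<Delta> ?Q w]
    by (simp add: obj_path_append)
qed simp

definition normalizer_of :: "'a set \<Rightarrow> 'a set" where
  "normalizer_of P = {x \<in> carrier L. P \<subseteq> conj_dom L x \<and> conj_set L P x = P}"

text \<open>The chain runs backwards along \<open>w\<close> to \<open>P\<close>, is fixed there by
  \<open>x\<close>, and then runs forward along \<open>w\<close> again.\<close>

lemma obj_path_conj:
  assumes "obj_path L \<Delta> P w" "x \<in> normalizer_of P"
  shows "word_inv L w @ [x] @ w \<in> wdom L"
  using obj_path_rev[OF assms(1)] assms obj_path_obj[OF assms(1)]
  by (intro obj_path_wdom[of "foldl (conj_set L) P w"]) (simp add: obj_path_append normalizer_of_def)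

lemma foldl_conj_set: "x \<in> P \<Longrightarrow> foldl (conj_elt L) x w \<in> foldl (conj_set L) P w"
  by (induction w arbitrary: x P) (auto simp: conj_set_def)

lemma subgroup_conj_self:
  assumes H: "pg_subgroup L H" and x: "x \<in> H"
  shows "H \<subseteq> conj_dom L x" "conj_set L H x = H"
proof -
  note D = pg_subgroupD[OF H]
  have c: "y \<in> conj_dom L x \<and> y \<up> x \<in> H" if "y \<in> H" "x \<in> H" for x y
    using that D(2)[of "[pinv x, y, x]"] D(4) partial_subgroupD(3)[OF D(1), of "[pinv x, y, x]"]
    by (auto intro!: conj_domI simp: conj_elt_def)
  show 1: "H \<subseteq> conj_dom L x" using c x by auto
  show "conj_set L H x = H"
  proof
    show "conj_set L H x \<subseteq> H" using c x by (auto simp: conj_set_def)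
    show "H \<subseteq> conj_set L H x"
    proof
      fix y assume y: "y \<in> H"
      have "y \<up> pinv x \<in> H" "y \<up> pinv x \<up> x = y"
        using c[of y "pinv x"] conj_pinv'(2)[of y x] D x y by auto
      thus "y \<in> conj_set L H x" unfolding conj_set_def by (metis image_eqI)
    qed
  qed
qed

lemma subgroup_normalizes_self: "pg_subgroup L H \<Longrightarrow> H \<subseteq> normalizer_of H"
  using subgroup_conj_self[of H] pg_subgroupD(3)[of H] by (auto simp: normalizer_of_def)

lemma obj_path_wprod:
  assumes "obj_path L \<Delta> P w" "x \<in> P"
  shows "x \<in> conj_dom L (wprod L w)" "x \<up> wprod L w \<in> foldl (conj_set L) P w"
proof -
  have D: "word_inv L w @ [x] @ w \<in> wdom L"
    using obj_path_conj[OF assms(1)] subgroup_normalizes_self[OF obj_subgroup[OF obj_path_obj[OF assms(1)]]] assms(2)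
    by auto
  show "x \<in> conj_dom L (wprod L w)" "x \<up> wprod L w \<in> foldl (conj_set L) P w"
    using conj_wprod[OF D] conj_word_foldl[OF D] foldl_conj_set[OF assms(2)] by simp_all
qed

text \<open>This is axiom (L3) with the unit as conjugating element.\<close>

lemma obj_overgroup:
  assumes "P \<in> \<Delta>" "pg_subgroup L Q" "Q \<subseteq> S" "P \<subseteq> Q"
  shows "Q \<in> \<Delta>"
proof -
  have Pc: "P \<subseteq> carrier L" using assms(1) obj_subgroup pg_subgroupD(3) by auto
  hence "conj_set L P \<e> = P" by (auto simp: conj_set_def subset_iff)
  moreover have "P \<subseteq> conj_dom L \<e>" using Pc by auto
  ultimately show ?thesis using assms obj_subgroup locality_overgroup[of Q P \<e>] by simp
qed

lemma obj_conj_S: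
  assumes P: "P \<in> \<Delta>" and s: "s \<in> S"
  shows "P \<subseteq> conj_dom L s" "conj_set L P s \<in> \<Delta>"
proof -
  have PS: "P \<subseteq> S" using P obj_subset by auto
  show 1: "P \<subseteq> conj_dom L s" using subgroup_conj_self(1)[OF S_subgroup s] PS by auto
  have 2: "conj_set L P s \<subseteq> S"
    using subgroup_conj_self(2)[OF S_subgroup s] conj_set_mono[OF PS] by auto
  moreover have "pg_subgroup L (conj_set L P s)"
    using obj_subgroup[OF P] S_subgroup 2 1
  proof (rule conj_set_subgroup)
    fix x y assume "x \<in> P" "y \<in> P"
    thus "[pinv s, x, s, pinv s, y, s] \<in> wdom L"
      using s PS S_D(4)[OF s] by (intro S_D(2)) auto
  qed
  ultimately show "conj_set L P s \<in> \<Delta>"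
    using locality_overgroup[of "conj_set L P s" P s] 1 P s S_D by auto
qed

text \<open>The point is that \<open>g\<close> is also the product of \<open>(a\<^sup>-\<^sup>1, g, a\<^sup>g)\<close>, so that conjugating by \<open>a\<close> an object
  on which \<open>g\<close> acts gives another such object.\<close>

lemma obj_conj_S_elt:
  assumes P: "P \<in> \<Delta>" "P \<subseteq> conj_dom L g" "conj_set L P g \<in> \<Delta>" and a: "a \<in> S_elt L S g"
  shows "conj_set L P a \<subseteq> conj_dom L g" "conj_set L (conj_set L P a) g \<in> \<Delta>"
proof -
  have aS: "a \<in> S" "a \<up> g \<in> S" "a \<in> conj_dom L g" using a by (auto simp: S_elt_def)
  let ?Q = "conj_set L P g" and ?w = "[pinv a, g, a \<up> g]"
  note Pa = obj_conj_S[OF P(1) aS(1)] and Qa = obj_conj_S[OF P(3) aS(2)]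
  have path: "obj_path L \<Delta> (conj_set L P a) ?w"
    using conj_set_pinv[OF Pa(1)] Pa Qa P by simp
  have end_path: "foldl (conj_set L) (conj_set L P a) ?w = conj_set L ?Q (a \<up> g)"
    using conj_set_pinv[OF Pa(1)] by simp
  note g = conj_domD[OF aS(3)]
  have agD: "[a, g] \<in> wdom L" using append_wdomD2[of "[pinv g]" "[a, g]"] g by simp
  have D1: "[] @ [pinv a] @ [a, g] \<in> wdom L" "wprod L [pinv a, a, g] = g"
    using cancel_left[of "[a]" "[g]"] agD g by (auto simp: wprod_singleton)
  have D2: "[g] @ [pinv g, a, g] @ [] \<in> wdom L" "wprod L [g, pinv g, a, g] = a \<cdot> g"
    using cancel_left[of "[pinv g]" "[a, g]"] g by (auto simp: winv_winv)
  have e: "g \<cdot> (a \<up> g) = a \<cdot> g"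
    using assoc_wprod[OF D2(1)] D2(2) by (simp add: conj_elt_def)
  have "[pinv a] @ [g, a \<up> g] @ [] \<in> wdom L" using obj_path_wdom[OF path] by simp
  from assoc_wprod[OF this] have "wprod L ?w = pinv a \<cdot> (a \<cdot> g)" using e by simp
  also have "\<dots> = g" using assoc_wprod[of "[pinv a]" "[a, g]" "[]"] D1 by simp
  finally have prod: "wprod L ?w = g" .
  note 1 = obj_path_wprod[OF path, unfolded prod end_path]
  show 2: "conj_set L P a \<subseteq> conj_dom L g" using 1 by auto
  have 3: "conj_set L (conj_set L P a) g \<subseteq> conj_set L ?Q (a \<up> g)" 
    using 1 unfolding conj_set_def[of L "conj_set L P a" g] by auto
  \<comment> \<open>The chain only gives an inclusion into an object; equal finite cardinalities
    make it an equality.\<close>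
  have "card (conj_set L (conj_set L P a) g) = card (conj_set L ?Q (a \<up> g))"
    using card_conj_set 2 Pa Qa P by metis
  moreover have "finite (conj_set L ?Q (a \<up> g))"
    using Qa obj_subset finite_S finite_subset by metis
  ultimately show "conj_set L (conj_set L P a) g \<in> \<Delta>"
    using 3 Qa(2) card_subset_eq by metis
qed

lemma ex_obj_conj: "g \<in> carrier L \<Longrightarrow> \<exists>P\<in>\<Delta>. P \<subseteq> conj_dom L g \<and> conj_set L P g \<in> \<Delta>"
  using wdom_iff_path[of "[g]"] singleton_wdom[of g] by auto

text \<open>For an object \<open>P\<close> carried by \<open>g\<close> to an object,
  \<open>P^a\<close> and its conjugate by \<open>b\<close> are carried by \<open>g\<close> to
  objects as well. So a chain starting at \<open>P^g\<close> runs along the whole word, and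
  conjugation by \<open>g\<close> becomes multiplicative on \<open>S_g\<close>.\<close>

lemma S_elt_wdom:
  assumes "a \<in> S_elt L S g" "b \<in> S_elt L S g"
  shows "[pinv g, a, g, pinv g, b, g] \<in> wdom L"
proof -
  have g: "g \<in> carrier L" using assms(1) conj_domD by (auto simp: S_elt_def)
  obtain P where P: "P \<in> \<Delta>" "P \<subseteq> conj_dom L g" "conj_set L P g \<in> \<Delta>"
    using ex_obj_conj[OF g] by auto
  have ab: "a \<in> S" "b \<in> S" using assms by (auto simp: S_elt_def)
  note 1 = obj_conj_S_elt[OF P assms(1)] and a = obj_conj_S[OF P(1) ab(1)]
  note 2 = obj_conj_S_elt[OF a(2) 1 assms(2)] and b = obj_conj_S[OF a(2) ab(2)]
  show ?thesis
    by (rule obj_path_wdom[of "conj_set L P g"])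
      (use P 1 2 a b conj_set_pinv[of P g] conj_set_pinv[of "conj_set L P a" g] in simp)
qed

lemma S_elt_mult:
  assumes "a \<in> S_elt L S g" "b \<in> S_elt L S g"
  shows "a \<cdot> b \<in> S_elt L S g" "(a \<cdot> b) \<up> g = (a \<up> g) \<cdot> (b \<up> g)"
  using conj_mult[OF S_elt_wdom[OF assms]] assms S_D by (auto simp: S_elt_def)

lemma S_elt_pinv:
  assumes "a \<in> S_elt L S g"
  shows "pinv a \<in> S_elt L S g" "pinv a \<up> g = pinv (a \<up> g)"
  using conj_dom_pinv[of a g] assms S_D by (auto simp: S_elt_def)

lemma punit_S_elt: "g \<in> carrier L \<Longrightarrow> \<e> \<in> S_elt L S g" "g \<in> carrier L \<Longrightarrow> \<e> \<up> g = \<e>"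
proof -
  assume g: "g \<in> carrier L"
  obtain P where P: "P \<in> \<Delta>" "P \<subseteq> conj_dom L g" "conj_set L P g \<in> \<Delta>"
    using ex_obj_conj[OF g] by auto
  have "\<e> \<in> P" using P obj_subgroup pg_subgroupD by blast
  hence "\<e> \<in> conj_dom L g" "\<e> \<up> g \<in> S" using P obj_subset[OF P(3)] by (auto simp: conj_set_def)
  thus *: "\<e> \<in> S_elt L S g" using S_D by (auto simp: S_elt_def)
  have "[pinv g] @ [] @ [g] \<in> wdom L" using g by simp
  from assoc_wprod[OF this] show "\<e> \<up> g = \<e>" using g by (simp add: conj_elt_def)
qed

lemma S_elt_subset: "S_elt L S g \<subseteq> S"
  by (auto simp: S_elt_def)

lemma conj_subgroup:
  assumes "pg_subgroup L P" "P \<subseteq> S_elt L S g"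
  shows "conj_set L P g \<subseteq> S" "pg_subgroup L (conj_set L P g)"
proof -
  show 1: "conj_set L P g \<subseteq> S" using assms by (auto simp: S_elt_def conj_set_def)
  show "pg_subgroup L (conj_set L P g)"
    using assms(1) S_subgroup 1
  proof (rule conj_set_subgroup)
    show "P \<subseteq> conj_dom L g" using assms by (auto simp: S_elt_def)
    fix x y assume "x \<in> P" "y \<in> P"
    thus "[pinv g, x, g, pinv g, y, g] \<in> wdom L" using assms S_elt_wdom by blast
  qed
qed

lemma S_elt_subgroup:
  assumes g: "g \<in> carrier L"
  shows "pg_subgroup L (S_elt L S g)"
proof (rule pg_subgroup_subset[OF S_subgroup _ S_elt_subset], rule partial_subgroupI)
  show "S_elt L S g \<noteq> {}" using punit_S_elt[OF g] by auto
qed (use S_elt_subset S_D S_elt_mult S_elt_pinv in auto)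

lemma obj_conj:
  assumes "P \<in> \<Delta>" "P \<subseteq> S_elt L S g"
  shows "conj_set L P g \<in> \<Delta>"
proof -
  note P = obj_subgroup[OF assms(1)]
  have PD: "P \<subseteq> conj_dom L g" using assms by (auto simp: S_elt_def)
  hence "g \<in> carrier L" using conj_domD(2)[of \<e> g] pg_subgroupD(5)[OF P] by auto
  thus ?thesis
    using locality_overgroup[OF conj_subgroup(2,1)[OF P assms(2)] assms(1) _ PD] conj_subgroup(2)[OF P assms(2)]
    by simp
qed

text \<open>Conjugates of an object that stay inside \<open>S\<close> are again objects, so the
  chain can be checked elementwise. Thus a word over the carrier lies in the domain exactly if
  \<open>word_conj_set\<close> contains an object, and that set is then an object itself.\<close>

lemma obj_path_word_conj_set: "obj_path L \<Delta> P w \<longleftrightarrow> P \<in> \<Delta> \<and> P \<subseteq> word_conj_set L S w"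
proof (induction w arbitrary: P)
  case Nil
  show ?case using obj_subset by auto
next
  case (Cons g w)
  show ?case
  proof
    assume *: "obj_path L \<Delta> P (g # w)"
    hence "conj_set L P g \<in> \<Delta>" "conj_set L P g \<subseteq> word_conj_set L S w" using Cons.IH by auto
    thus "P \<in> \<Delta> \<and> P \<subseteq> word_conj_set L S (g # w)"
      using * obj_subset[of P] obj_subset[of "conj_set L P g"]
      by (auto simp: S_elt_def conj_set_def)
  next
    assume "P \<in> \<Delta> \<and> P \<subseteq> word_conj_set L S (g # w)"
    thus "obj_path L \<Delta> P (g # w)"
      using obj_conj[of P g] Cons.IH[of "conj_set L P g"] by (auto simp: S_elt_def conj_set_def)
  qed
qed

lemma wdom_iff: "w \<in> lists (carrier L) \<Longrightarrow> w \<in> wdom L \<longleftrightarrow> (\<exists>P\<in>\<Delta>. P \<subseteq> word_conj_set L S w)"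
  by (auto simp add: wdom_iff_path obj_path_word_conj_set)

lemma wdomI: "P \<in> \<Delta> \<Longrightarrow> P \<subseteq> word_conj_set L S w \<Longrightarrow> w \<in> wdom L"
  using obj_path_wdom[of P w] obj_path_word_conj_set[of P w] by simp

lemma word_conj_set_subgroup:
  assumes "w \<in> lists (carrier L)"
  shows "pg_subgroup L (word_conj_set L S w)"
  using assms
proof (induction w rule: list.induct)
  case (Cons g w)
  have g: "g \<in> carrier L" and w: "pg_subgroup L (word_conj_set L S w)" using Cons by auto
  note D = pg_subgroupD[OF w]
  show ?case
  proof (rule pg_subgroup_subset[OF S_subgroup _ word_conj_set_subset], rule partial_subgroupI)
    show "word_conj_set L S (g # w) \<noteq> {}" using punit_S_elt[OF g] D by auto
    show "word_conj_set L S (g # w) \<subseteq> carrier L" using word_conj_set_subset[of L S "g # w"] S_D(3) by simp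
    show "pinv h \<in> word_conj_set L S (g # w)" if "h \<in> word_conj_set L S (g # w)" for h
      using that D(4) S_elt_pinv[of h g] by simp
    show "x \<cdot> y \<in> word_conj_set L S (g # w)"
      if "x \<in> word_conj_set L S (g # w)" "y \<in> word_conj_set L S (g # w)" for x y
      using that D(6) S_elt_mult[of x g y] by simp
  qed
qed (simp add: S_subgroup)

lemma word_conj_set_obj:
  assumes "w \<in> wdom L"
  shows "word_conj_set L S w \<in> \<Delta>"
proof -
  have w: "w \<in> lists (carrier L)" using assms wdom_words by auto
  then obtain P where "P \<in> \<Delta>" "P \<subseteq> word_conj_set L S w" using wdom_iff assms by auto
  thus ?thesis using obj_overgroup word_conj_set_subgroup[OF w] word_conj_set_subset by metis
qed

lemma S_elt_eq: "S_elt L S g = word_conj_set L S [g]"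
  by (auto simp: S_elt_def)

lemma S_elt_obj: "g \<in> carrier L \<Longrightarrow> S_elt L S g \<in> \<Delta>"
  unfolding S_elt_eq by (intro word_conj_set_obj singleton_wdom)

text \<open>Conjugation along \<open>w\<close> is controlled for all elements normalizing
  \<open>P\<close>, even if they or their conjugates lie outside \<open>S\<close>.\<close>

lemma conj_word_wprod:
  assumes P: "P \<in> \<Delta>" "P \<subseteq> word_conj_set L S w" and x: "x \<in> normalizer_of P"
  shows "x \<in> conj_dom L (wprod L w)" "x \<up> wprod L w = foldl (conj_elt L) x w"
    "word_inv L w @ [x] @ w \<in> wdom L"
proof -
  show D: "word_inv L w @ [x] @ w \<in> wdom L"
    using P x obj_path_conj[of P w x] obj_path_word_conj_set[of P w] by simp
  show "x \<in> conj_dom L (wprod L w)" "x \<up> wprod L w = foldl (conj_elt L) x w"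
    using conj_wprod[OF D] conj_word_foldl[OF D] by simp_all
qed

lemma word_conj_set_wprod:
  assumes w: "w \<in> wdom L" and s: "s \<in> word_conj_set L S w"
  shows "s \<in> S_elt L S (wprod L w)" "s \<up> wprod L w = foldl (conj_elt L) s w"
proof -
  have D: "word_conj_set L S w \<in> \<Delta>" using word_conj_set_obj[OF w] .
  have "s \<in> normalizer_of (word_conj_set L S w)"
    using subgroup_normalizes_self[OF obj_subgroup[OF D]] s by auto
  from conj_word_wprod[OF D _ this] 
  show "s \<in> S_elt L S (wprod L w)" "s \<up> wprod L w = foldl (conj_elt L) s w"
    using foldl_word_conj_set[OF s] subsetD[OF word_conj_set_subset s] by (auto simp: S_elt_def)
qed

end

section \<open>Normalizers of objects and cosets of partial normal subgroups\<close>

context locality begin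

lemma finite_pg: "X \<subseteq> carrier L \<Longrightarrow> finite X"
  using finite_carrier finite_subset by auto

lemma normalizerI:
  assumes "x \<in> carrier L" "P \<subseteq> conj_dom L x" "\<And>y. y \<in> P \<Longrightarrow> y \<up> x \<in> P"
  shows "x \<in> normalizer_of P"
proof -
  have "finite P" using assms(2) conj_domD(1) by (intro finite_pg) auto
  moreover have "conj_set L P x \<subseteq> P" using assms(3) by (auto simp: conj_set_def)
  ultimately have "conj_set L P x = P"
    using card_subset_eq card_conj_set[OF assms(2)] by blast
  thus ?thesis using assms by (simp add: normalizer_of_def)
qed

lemma obj_path_normalizer:
  assumes "obj_path L \<Delta> P w" "foldl (conj_set L) P w = P"
  shows "wprod L w \<in> normalizer_of P"
  using obj_path_wprod[OF assms(1)] assms(2) obj_path_wdom[OF assms(1)]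
  by (intro normalizerI) (auto simp: wprod_closed)

text \<open>Every word in the normalizer has the constant chain at \<open>P\<close>, hence a
  product.\<close>

lemma normalizer_subgroup:
  assumes P: "P \<in> \<Delta>"
  shows "pg_subgroup L (normalizer_of P)"
proof -
  have path: "obj_path L \<Delta> P w \<and> foldl (conj_set L) P w = P" if "w \<in> lists (normalizer_of P)" for w
    using that by (induction w rule: list.induct) (auto simp: P normalizer_of_def)
  have "\<e> \<in> normalizer_of P" using path[of "[]"] obj_path_normalizer[of P "[]"] by simp
  moreover have "pinv h \<in> normalizer_of P" if "h \<in> normalizer_of P" for h
    using that conj_set_pinv[of P h] by (auto simp: normalizer_of_def)
  moreover have "x \<cdot> y \<in> normalizer_of P" if "x \<in> normalizer_of P" "y \<in> normalizer_of P" for x y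
    using path[of "[x, y]"] obj_path_normalizer[of P "[x, y]"] that by simp
  ultimately have "partial_subgroup L (normalizer_of P)"
    by (intro partial_subgroupI) (auto simp: normalizer_of_def)
  moreover have "lists (normalizer_of P) \<subseteq> wdom L"
    using path obj_path_wdom by blast
  ultimately show ?thesis by (simp add: pg_subgroup_def)
qed

text \<open>Starting from \<open>P^g\<close>, the chain along \<open>(g^-1, x, g)\<close> passes
  through \<open>P\<close> twice and returns to \<open>P^g\<close>.\<close>

lemma conj_normalizer:
  assumes P: "P \<in> \<Delta>" "P \<subseteq> S_elt L S g" and x: "x \<in> normalizer_of P"
  shows "x \<in> conj_dom L g" "x \<up> g \<in> normalizer_of (conj_set L P g)"
proof -
  have PD: "P \<subseteq> conj_dom L g" using P by (auto simp: S_elt_def)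
  have path: "obj_path L \<Delta> (conj_set L P g) [pinv g, x, g]"
    "foldl (conj_set L) (conj_set L P g) [pinv g, x, g] = conj_set L P g"
    using conj_set_pinv[OF PD] obj_conj[OF P] P x PD by (auto simp: normalizer_of_def)
  show "x \<in> conj_dom L g" using obj_path_wdom[OF path(1)] by (rule conj_domI)
  show "x \<up> g \<in> normalizer_of (conj_set L P g)"
    using obj_path_normalizer[OF path] by (simp add: conj_elt_def)
qed

lemma conj_normalizer_mult:
  assumes P: "P \<in> \<Delta>" "P \<subseteq> S_elt L S g" and x: "x \<in> normalizer_of P" "y \<in> normalizer_of P"
  shows "(x \<cdot> y) \<up> g = (x \<up> g) \<cdot> (y \<up> g)" "[pinv g, x, g, pinv g, y, g] \<in> wdom L"
proof -
  have PD: "P \<subseteq> conj_dom L g" using P by (auto simp: S_elt_def)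
  show D: "[pinv g, x, g, pinv g, y, g] \<in> wdom L"
    by (rule obj_path_wdom[of "conj_set L P g"])
      (use conj_set_pinv[OF PD] obj_conj[OF P] P x PD in \<open>simp add: normalizer_of_def\<close>)
  show "(x \<cdot> y) \<up> g = (x \<up> g) \<cdot> (y \<up> g)" using conj_mult(4)[OF D] .
qed

lemma conj_set_normalizer:
  assumes P: "P \<in> \<Delta>" "P \<subseteq> S_elt L S g" and B: "pg_subgroup L B" "B \<subseteq> normalizer_of P"
  shows "pg_subgroup L (conj_set L B g)" "conj_set L B g \<subseteq> normalizer_of (conj_set L P g)"
    "card (conj_set L B g) = card B"
proof -
  have BD: "B \<subseteq> conj_dom L g" using conj_normalizer[OF P] B by auto
  show 1: "conj_set L B g \<subseteq> normalizer_of (conj_set L P g)"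
    using conj_normalizer[OF P] B by (auto simp: conj_set_def)
  show "pg_subgroup L (conj_set L B g)"
    using B(1) normalizer_subgroup[OF obj_conj[OF P]] 1 BD
    by (rule conj_set_subgroup) (use conj_normalizer_mult(2)[OF P] B in auto)
  show "card (conj_set L B g) = card B" using BD by (rule card_conj_set)
qed

section \<open>Growth and conjugation of p-subgroups\<close>

lemma p_subgroup_S:
  assumes "pg_subgroup L Q" "Q \<subseteq> S"
  shows "pg_p_subgroup p L Q"
proof -
  interpret group "group_of L S" using S_subgroup by (rule group_group_of)
  have "subgroup Q (group_of L S)" using assms subgroup_group_of_iff[OF S_subgroup] by simp
  from lagrange[OF this] have "card Q dvd card S" by (simp add: order_def dvdI[of _ _ "card (rcosets\<^bsub>group_of L S\<^esub> Q)"] mult.commute)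
  then obtain i where "card Q = p ^ i" using card_S prime_p divides_primepow_nat by metis
  thus ?thesis using assms finite_S finite_subset by (auto simp: pg_p_subgroup_def)
qed

text \<open>For a \<open>p\<close>-subgroup \<open>P\<close> of \<open>H\<close> this says that \<open>P\<close> is a Sylow subgroup.\<close>

definition sylow_in :: "'a set \<Rightarrow> 'a set \<Rightarrow> bool" where
  "sylow_in P H \<longleftrightarrow> \<not> p dvd card (rcosets\<^bsub>group_of L H\<^esub> P)"

lemma p_subgroup_grows:
  assumes H: "pg_subgroup L H" and P: "pg_p_subgroup p L P" "P \<subseteq> H" and "\<not> sylow_in P H"
  shows "\<exists>Q. pg_p_subgroup p L Q \<and> P \<subset> Q \<and> Q \<subseteq> H \<and> Q \<subseteq> normalizer_of P"
proof -
  interpret group "group_of L H" using H by (rule group_group_of)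
  have fin: "finite H" using H pg_subgroupD(3) finite_pg by auto
  have Ps: "subgroup P (group_of L H)" using P subgroup_group_of_iff[OF H] by (auto simp: pg_p_subgroup_def)
  obtain a where a: "card P = p ^ a" using P by (auto simp: pg_p_subgroup_def)
  obtain Q c where Q: "subgroup Q (group_of L H)" "card Q = p ^ c" "P \<subset> Q"
    "\<forall>x\<in>Q. \<forall>y\<in>P. inv\<^bsub>group_of L H\<^esub> x \<otimes>\<^bsub>group_of L H\<^esub> y \<otimes>\<^bsub>group_of L H\<^esub> x \<in> P"
    using p_subgroup_normalizer_grows[OF prime_p _ Ps a] assms(4) fin by (auto simp: sylow_in_def)
  have QH: "pg_subgroup L Q" "Q \<subseteq> H" using Q(1) subgroup_group_of_iff[OF H] by auto
  note HD = pg_subgroupD[OF H]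
  have D: "[pinv x, y, x] \<in> wdom L" if "x \<in> Q" "y \<in> P" for x y
    using that QH P HD by (intro HD(2)) auto
  have "y \<up> x \<in> P" if "x \<in> Q" "y \<in> P" for x y
  proof -
    have "inv\<^bsub>group_of L H\<^esub> x = pinv x" using inv_group_of[OF H, of x] QH that by auto
    moreover have "inv\<^bsub>group_of L H\<^esub> x \<otimes>\<^bsub>group_of L H\<^esub> y \<otimes>\<^bsub>group_of L H\<^esub> x \<in> P" using Q(4) that by blast
    ultimately show ?thesis using conj_elt_eq[OF D[OF that]] by simp
  qed
  hence "Q \<subseteq> normalizer_of P"
    using D QH HD(3) by (auto intro!: normalizerI conj_domI)
  thus ?thesis using Q(2,3) QH finite_subset[OF QH(2) fin] unfolding pg_p_subgroup_def by blast
qed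

text \<open>The index of a proper subgroup of the \<open>p\<close>-group \<open>Q\<close> is a
  nontrivial power of \<open>p\<close>, so \<open>P\<close> is not a Sylow subgroup of
  \<open>Q\<close> and has a larger normalizer in it.\<close>

lemma S_subgroup_grows:
  assumes Q: "pg_subgroup L Q" "Q \<subseteq> S" and P: "pg_subgroup L P" "P \<subset> Q"
  shows "\<exists>A. pg_subgroup L A \<and> P \<subset> A \<and> A \<subseteq> Q \<and> A \<subseteq> normalizer_of P"
proof -
  interpret group "group_of L Q" using Q(1) by (rule group_group_of)
  have Pp: "pg_p_subgroup p L P" using P Q by (intro p_subgroup_S) auto
  obtain a b where ab: "card P = p ^ a" "card Q = p ^ b"
    using Pp p_subgroup_S[OF Q] by (auto simp: pg_p_subgroup_def)
  have Ps: "subgroup P (group_of L Q)" using P subgroup_group_of_iff[OF Q(1)] by auto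
  have finQ: "finite Q" using Q finite_S finite_subset by auto
  hence "card P < card Q" using P psubset_card_mono by auto
  have eq: "card (rcosets\<^bsub>group_of L Q\<^esub> P) * p ^ a = p ^ b"
    using lagrange[OF Ps] ab by (simp add: order_def)
  then obtain i where i: "card (rcosets\<^bsub>group_of L Q\<^esub> P) = p ^ i"
    using divides_primepow_nat[OF prime_p] by (metis dvd_triv_left)
  have "i \<noteq> 0"
  proof
    assume "i = 0"
    with eq i ab \<open>card P < card Q\<close> show False by simp
  qed
  hence "\<not> sylow_in P Q" using i by (simp add: sylow_in_def)
  from p_subgroup_grows[OF Q(1) Pp _ this] P show ?thesis
    unfolding pg_p_subgroup_def by blast
qed

lemma sylow_in_conj:
  assumes H: "pg_subgroup L H" and P: "pg_subgroup L P" "P \<subseteq> H" "sylow_in P H"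
    and B: "pg_p_subgroup p L B" "B \<subseteq> H"
  shows "\<exists>g\<in>H. B \<subseteq> conj_dom L g \<and> conj_set L B g \<subseteq> P"
proof -
  interpret group "group_of L H" using H by (rule group_group_of)
  have fin: "finite H" using H pg_subgroupD(3) finite_pg by auto
  note HD = pg_subgroupD[OF H]
  have Ps: "subgroup P (group_of L H)" using P subgroup_group_of_iff[OF H] by auto
  have Bs: "subgroup B (group_of L H)" using B subgroup_group_of_iff[OF H] by (auto simp: pg_p_subgroup_def)
  obtain b where b: "card B = p ^ b" using B by (auto simp: pg_p_subgroup_def)
  obtain g where g: "g \<in> H" 
    "\<forall>b\<in>B. inv\<^bsub>group_of L H\<^esub> g \<otimes>\<^bsub>group_of L H\<^esub> b \<otimes>\<^bsub>group_of L H\<^esub> g \<in> P"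
    using sylow_conj[OF prime_p _ Ps _ Bs b] fin P(3) by (auto simp: sylow_in_def)
  have D: "[pinv g, y, g] \<in> wdom L" if "y \<in> B" for y
    using that g B HD by (intro HD(2)) auto
  have "y \<up> g \<in> P" if "y \<in> B" for y
    using conj_elt_eq[OF D[OF that]] g that inv_group_of[OF H g(1)] by auto
  thus ?thesis using D g(1) by (auto intro!: bexI[of _ g] conj_domI simp: conj_set_def)
qed

section \<open>Cosets of partial normal subgroups with representatives in S\<close>

text \<open>\<open>x\<close> lies in the coset \<open>Ms\<close>. On the product of \<open>M\<close> and \<open>S\<close> this relation plays the role of the
  homomorphism onto the quotient of \<open>S\<close> by \<open>M \<inter> S\<close>.\<close>

definition in_coset :: "'a set \<Rightarrow> 'a \<Rightarrow> 'a \<Rightarrow> bool" where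
  "in_coset M x s \<longleftrightarrow> x \<in> carrier L \<and> s \<in> S \<and> x \<cdot> pinv s \<in> M"

text \<open>The set \<open>MS\<close>, described by the cosets \<open>Ms\<close> so that the
  representatives in \<open>S\<close> remain accessible.\<close>

definition S_product :: "'a set \<Rightarrow> 'a set" where
  "S_product M = {x. \<exists>s. in_coset M x s}"

lemma S_conj:
  assumes "s \<in> S" "t \<in> S"
  shows "t \<in> S_elt L S s" "t \<up> s \<in> S"
  using subgroup_conj_self[OF S_subgroup assms(1)] assms by (auto simp: S_elt_def conj_set_def)

lemma S_conj_pinv:
  assumes "s \<in> S" "t \<in> S"
  shows "t \<up> s \<up> pinv s = t" "t \<up> pinv s \<up> s = t"
  using conj_pinv(2)[of t s] conj_pinv'(2)[of t s] S_conj[OF assms] S_conj[of "pinv s" t] S_D assms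
  by (auto simp: S_elt_def)

lemma wdom_S_right:
  assumes "x \<in> carrier L" "set w \<subseteq> S"
  shows "x # w \<in> wdom L"
proof -
  have "S \<subseteq> word_conj_set L S w" using assms(2)
    by (induction w) (auto simp: S_conj)
  hence "S_elt L S x \<subseteq> word_conj_set L S (x # w)" by (auto simp: S_elt_def)
  thus ?thesis using S_elt_obj[OF assms(1)] by (rule wdomI[rotated])
qed

lemma in_coset_carrier: "in_coset M x s \<Longrightarrow> x \<in> carrier L" "in_coset M x s \<Longrightarrow> s \<in> S"
  by (auto simp: in_coset_def)

lemma in_coset_mono: "in_coset M x s \<Longrightarrow> M \<subseteq> N \<Longrightarrow> in_coset N x s"
  by (auto simp: in_coset_def)

lemma in_coset_Int: "in_coset (M \<inter> N) x s \<longleftrightarrow> in_coset M x s \<and> in_coset N x s"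
  by (auto simp: in_coset_def)

lemma in_coset_punit_iff: "in_coset M x \<e> \<longleftrightarrow> x \<in> carrier L \<and> x \<in> M"
  using S_D by (auto simp: in_coset_def)

lemma in_coset_self: "partial_subgroup L M \<Longrightarrow> s \<in> S \<Longrightarrow> in_coset M s s"
  using S_D partial_subgroupD(4)[of M] by (auto simp: in_coset_def)

text \<open>Inserting \<open>s^-1 s\<close> after \<open>x\<close> writes \<open>xy(st)^-1\<close>
  as \<open>xs^-1\<close> times the conjugate of \<open>yt^-1\<close> by \<open>s^-1\<close>, and
  both factors lie in \<open>M\<close>.\<close>

lemma in_coset_mult:
  assumes M: "partial_normal_subgroup L M"
    and x: "in_coset M x s" and y: "in_coset M y t" and xy: "[x, y] \<in> wdom L"
  shows "in_coset M (x \<cdot> y) (s \<cdot> t)"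
proof -
  note M' = partial_subgroupD[OF partial_normalD(1)[OF M]]
  have c: "x \<in> carrier L" "y \<in> carrier L" "s \<in> S" "t \<in> S" "x \<cdot> pinv s \<in> M" "y \<cdot> pinv t \<in> M"
    using x y by (auto simp: in_coset_def)
  have sc: "s \<in> carrier L" "t \<in> carrier L" using c S_D by auto
  let ?w = "[x, pinv s, s, y, pinv t, pinv s]"
  \<comment> \<open>Conjugation by elements of \<open>S\<close> never leads out of \<open>S\<close>,
    so every element of \<open>S_(x,y)\<close> can be carried along the longer word.\<close>
  have D: "?w \<in> wdom L"
  proof (rule wdomI[OF word_conj_set_obj[OF xy]], rule subsetI)
    fix a assume a: "a \<in> word_conj_set L S [x, y]"
    hence "a \<in> S_elt L S x" "a \<up> x \<in> S_elt L S y" "a \<up> x \<up> y \<in> S" "a \<up> x \<in> S" by (auto simp: S_elt_def)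
    thus "a \<in> word_conj_set L S ?w" using c S_D by (simp add: S_conj S_conj_pinv)
  qed
  have "concat [[x, pinv s], [s], [y, pinv t], [pinv s]] \<in> wdom L" using D by simp
  from wprod_concat[OF this] have
    "[x \<cdot> pinv s, s, y \<cdot> pinv t, pinv s] \<in> wdom L" and
    e1: "wprod L [x \<cdot> pinv s, s, y \<cdot> pinv t, pinv s] = wprod L ?w"
    using c sc by (simp_all add: wprod_singleton)
  hence D1: "concat [[x \<cdot> pinv s], [s, y \<cdot> pinv t, pinv s]] \<in> wdom L" by simp
  have cj: "(y \<cdot> pinv t) \<up> pinv s = wprod L [s, y \<cdot> pinv t, pinv s]"
    using sc by (simp add: conj_elt_def winv_winv)
  have "(y \<cdot> pinv t) \<up> pinv s \<in> M"
    using append_wdomD2[of "[x \<cdot> pinv s]"] D1 c(6) sc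
    by (intro partial_normalD(2)[OF M] conj_domI) (auto simp: winv_winv)
  moreover have "[x \<cdot> pinv s, (y \<cdot> pinv t) \<up> pinv s] \<in> wdom L"
    "(x \<cdot> pinv s) \<cdot> ((y \<cdot> pinv t) \<up> pinv s) = wprod L ?w"
    using wprod_concat[OF D1] c(5) M'(1) e1 cj by (auto simp: wprod_singleton subset_iff)
  ultimately have w: "wprod L ?w \<in> M" using M'(5) c(5) by metis
  have D2: "concat [[x, pinv s, s, y], [pinv t, pinv s]] \<in> wdom L" using D by simp
  have "concat [[x], [pinv s, s], [y]] \<in> wdom L"
    using append_wdomD1[of "[x, pinv s, s, y]"] D by simp
  from wprod_concat[OF this] have D3: "concat [[x, \<e>], [y]] \<in> wdom L" "wprod L [x, \<e>, y] = wprod L [x, pinv s, s, y]"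
    using c sc by (simp_all add: wprod_singleton)
  have "wprod L [x, pinv s, s, y] = x \<cdot> y" using wprod_concat(2)[OF D3(1)] D3(2) c by (simp add: wprod_singleton)
  moreover have "pinv t \<cdot> pinv s = pinv (s \<cdot> t)"
    using pinv_mult[of s t] S_D(2)[of "[s, t]"] c by simp
  ultimately have "x \<cdot> y \<cdot> pinv (s \<cdot> t) = wprod L ?w" using wprod_concat(2)[OF D2] by simp
  thus ?thesis using w c S_D xy by (auto simp: in_coset_def wprod_closed)
qed

text \<open>The element \<open>x^-1 s\<close> is the conjugate by \<open>s\<close> of
  \<open>s x^-1\<close>, the inverse of \<open>x s^-1\<close>.\<close>

lemma in_coset_pinv:
  assumes M: "partial_normal_subgroup L M" and x: "in_coset M x s"
  shows "in_coset M (pinv x) (pinv s)"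
proof -
  note M' = partial_subgroupD[OF partial_normalD(1)[OF M]]
  have c: "x \<in> carrier L" "s \<in> S" "x \<cdot> pinv s \<in> M"
    using x by (auto simp: in_coset_def)
  have sc: "s \<in> carrier L" using c S_D by auto
  let ?w = "[pinv s, s, pinv x, s]"
  have "[x, pinv s] \<in> wdom L" using c S_D by (intro wdom_S_right) auto
  hence m: "s \<cdot> pinv x \<in> M" using pinv_mult[of x "pinv s"] M'(2)[OF c(3)] sc by (simp add: winv_winv)
  have D: "?w \<in> wdom L"
  proof (rule wdomI[OF S_elt_obj[of "pinv x"]])
    show "S_elt L S (pinv x) \<subseteq> word_conj_set L S ?w"
    proof (rule subsetI)
      fix a assume "a \<in> S_elt L S (pinv x)"
      hence "a \<in> S_elt L S (pinv x)" "a \<up> pinv x \<in> S" "a \<in> S" by (auto simp: S_elt_def)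
      thus "a \<in> word_conj_set L S ?w" using c S_D by (simp add: S_conj S_conj_pinv)
    qed
  qed (use c in simp)
  have "concat [[pinv s], [s, pinv x], [s]] \<in> wdom L" using D by simp
  from wprod_concat[OF this] have "[pinv s, s \<cdot> pinv x, s] \<in> wdom L"
    "(s \<cdot> pinv x) \<up> s = wprod L ?w" using sc by (simp_all add: wprod_singleton conj_elt_def)
  hence "wprod L ?w \<in> M" using partial_normalD(2)[OF M m conj_domI] by metis
  moreover have D1: "concat [[pinv s, s], [pinv x, s]] \<in> wdom L" using D by simp
  have "wprod L [pinv x, s] = wprod L ?w"
    using wprod_concat(2)[OF D1] append_wdomD2[of "[pinv s, s]" "[pinv x, s]"] D sc by (simp add: wprod_closed)
  ultimately show ?thesis using c sc S_D by (auto simp: in_coset_def winv_winv)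
qed

lemma S_product_subgroup:
  assumes M: "partial_normal_subgroup L M"
  shows "partial_subgroup L (S_product M)" "S \<subseteq> S_product M" "M \<subseteq> S_product M"
proof -
  note M' = partial_subgroupD[OF partial_normalD(1)[OF M]]
  show S: "S \<subseteq> S_product M" using in_coset_self[OF partial_normalD(1)[OF M]] by (auto simp: S_product_def)
  show "M \<subseteq> S_product M" using in_coset_punit_iff M'(1) by (auto simp: S_product_def)
  show "partial_subgroup L (S_product M)"
  proof (rule partial_subgroupI)
    show "S_product M \<noteq> {}" using S S_D by auto
    show "S_product M \<subseteq> carrier L" using in_coset_carrier by (auto simp: S_product_def)
  qed (use in_coset_mult[OF M] in_coset_pinv[OF M] in \<open>unfold S_product_def, blast+\<close>)
qed

lemma S_product_mono: "M \<subseteq> N \<Longrightarrow> S_product M \<subseteq> S_product N"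
  using in_coset_mono[of M _ _ N] unfolding S_product_def by blast

text \<open>With the order of \<open>S\<close> as exponent the representative becomes trivial, so
  that power of \<open>x\<close> lies in \<open>M\<close>.\<close>

lemma in_coset_pow:
  assumes M: "partial_normal_subgroup L M" and H: "pg_subgroup L H" and x: "x \<in> H" "in_coset M x s"
  shows "in_coset M (x [^]\<^bsub>group_of L H\<^esub> (n :: nat)) (s [^]\<^bsub>group_of L S\<^esub> n)"
proof (induction n)
  case 0
  then show ?case using M in_coset_self[OF partial_normalD(1)[OF M] S_D(5)] by (simp add: nat_pow_def)
next
  case (Suc n)
  interpret group "group_of L H" using H by (rule group_group_of)
  have "x [^]\<^bsub>group_of L H\<^esub> n \<in> H" using nat_pow_closed[of x n] x by simp
  hence "[x [^]\<^bsub>group_of L H\<^esub> n, x] \<in> wdom L" using pg_subgroupD(2)[OF H] x by simp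
  from in_coset_mult[OF M Suc.IH x(2) this] show ?case by (simp add: nat_pow_def)
qed

text \<open>Let \<open>H\<close> be the normalizer of \<open>R\<close> in
  \<open>MS \<inter> NS\<close>. Powers of its elements with exponent the order of \<open>S\<close>
  lie in both \<open>M\<close> and \<open>N\<close>. Hence \<open>sylow_times_normal\<close> gives
  \<open>H = (H \<inter> M \<inter> N) P\<close> with \<open>P\<close> the normalizer of
  \<open>R\<close> in \<open>S\<close>.\<close>

lemma sylow_normalizer_S_product:
  assumes M: "partial_normal_subgroup L M" and N: "partial_normal_subgroup L N" and R: "R \<in> \<Delta>"
    and syl: "sylow_in (normalizer_of R \<inter> S) (normalizer_of R \<inter> (S_product M \<inter> S_product N))"
  shows "normalizer_of R \<inter> (S_product M \<inter> S_product N) \<subseteq> S_product (M \<inter> N)"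
proof -
  define H where "H = normalizer_of R \<inter> (S_product M \<inter> S_product N)"
  note K = partial_normal_Int[OF M N]
  note SM = S_product_subgroup[OF M] and SN = S_product_subgroup[OF N]
  note NR = normalizer_subgroup[OF R]
  have H: "pg_subgroup L H" unfolding H_def
    by (rule pg_subgroup_subset[OF NR])
      (use partial_subgroup_Int[OF pg_subgroupD(1)[OF NR] partial_subgroup_Int[OF SM(1) SN(1)]] in auto)
  interpret group "group_of L H" using H by (rule group_group_of)
  interpret S: group "group_of L S" using S_subgroup by (rule group_group_of)
  note HD = pg_subgroupD[OF H]
  have fin: "finite (carrier (group_of L H))" using HD finite_pg by simp
  define P where "P = normalizer_of R \<inter> S"
  have "pg_subgroup L P" unfolding P_def
    by (rule pg_subgroup_subset[OF S_subgroup])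
      (use partial_subgroup_Int[OF pg_subgroupD(1)[OF NR] S_D(1)] in auto)
  moreover have "P \<subseteq> H" using SM SN by (auto simp: P_def H_def)
  ultimately have P: "subgroup P (group_of L H)" using subgroup_group_of_iff[OF H] by auto
  have ind: "\<not> p dvd card (rcosets\<^bsub>group_of L H\<^esub> P)"
    using syl by (simp add: sylow_in_def H_def P_def)
  have "partial_subgroup L (H \<inter> (M \<inter> N))"
    using partial_subgroup_Int[OF HD(1) partial_normalD(1)[OF K]] .
  hence "pg_subgroup L (H \<inter> (M \<inter> N))" using pg_subgroup_subset[OF H] by auto
  hence HK: "subgroup (H \<inter> (M \<inter> N)) (group_of L H)" using subgroup_group_of_iff[OF H] by auto
  have nrm: "H \<inter> (M \<inter> N) \<lhd> group_of L H"
    unfolding normal_inv_iff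
  proof (intro conjI ballI HK)
    fix x h assume x: "x \<in> carrier (group_of L H)" and h: "h \<in> H \<inter> (M \<inter> N)"
    have D: "[pinv (pinv x), h, pinv x] \<in> wdom L" using HD x h by (intro HD(2)) auto
    have "h \<up> pinv x = x \<otimes>\<^bsub>group_of L H\<^esub> h \<otimes>\<^bsub>group_of L H\<^esub> inv\<^bsub>group_of L H\<^esub> x"
      using conj_elt_eq[OF D] x HD(3) inv_group_of[OF H, of x] by (auto simp: winv_winv subset_iff)
    moreover have "h \<up> pinv x \<in> M \<inter> N" using partial_normalD(2)[OF K _ conj_domI[OF D]] h by auto
    moreover have "x \<otimes>\<^bsub>group_of L H\<^esub> h \<otimes>\<^bsub>group_of L H\<^esub> inv\<^bsub>group_of L H\<^esub> x \<in> H"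
      using m_closed[of "x \<otimes>\<^bsub>group_of L H\<^esub> h" "inv\<^bsub>group_of L H\<^esub> x"] m_closed[of x h] x h inv_closed[of x] by simp
    ultimately show "x \<otimes>\<^bsub>group_of L H\<^esub> h \<otimes>\<^bsub>group_of L H\<^esub> inv\<^bsub>group_of L H\<^esub> x \<in> H \<inter> (M \<inter> N)" by auto
  qed
  obtain k where k: "card S = p ^ k" using card_S by auto
  have pow: "h [^]\<^bsub>group_of L H\<^esub> (p ^ k) \<in> H \<inter> (M \<inter> N)" if h: "h \<in> carrier (group_of L H)" for h
  proof -
    have one: "s [^]\<^bsub>group_of L S\<^esub> (p ^ k) = \<e>" if "s \<in> S" for s
      using S.pow_order_eq_1[of s] k that by (simp add: order_def)
    \<comment> \<open>The representatives of \<open>h\<close> for \<open>M\<close> and for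
      \<open>N\<close> may differ, but the same exponent kills both.\<close>
    have "h [^]\<^bsub>group_of L H\<^esub> (p ^ k) \<in> X" if X: "partial_normal_subgroup L X" "H \<subseteq> S_product X" for X
    proof -
      obtain s where s: "in_coset X h s" using X h by (auto simp: S_product_def)
      show ?thesis
        using in_coset_pow[OF X(1) H _ s, of "p ^ k"] one[OF in_coset_carrier(2)[OF s]] h
        by (simp add: in_coset_punit_iff)
    qed
    from this[OF M] this[OF N] show ?thesis using nat_pow_closed[OF h, of "p ^ k"] by (auto simp: H_def)
  qed
  have eq: "H = (H \<inter> (M \<inter> N)) <#>\<^bsub>group_of L H\<^esub> P"
    using sylow_times_normal[OF prime_p fin P ind nrm pow] by simp
  have "h \<in> S_product (M \<inter> N)" if "h \<in> H" for h
  proof -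
    have "h \<in> (H \<inter> (M \<inter> N)) <#>\<^bsub>group_of L H\<^esub> P" using that eq by simp
    then obtain k q where kq: "k \<in> H" "k \<in> M \<inter> N" "q \<in> P" "h = k \<cdot> q" by (auto simp: set_mult_def)
    have "k \<in> S_product (M \<inter> N)" "q \<in> S_product (M \<inter> N)"
      using S_product_subgroup[OF K] kq by (auto simp: P_def)
    moreover have "[k, q] \<in> wdom L" using kq subgroup.subset[OF P] by (intro HD(2)) auto
    ultimately show ?thesis using partial_subgroupD(5)[OF S_product_subgroup(1)[OF K]] kq by simp
  qed
  thus ?thesis by (auto simp: H_def)
qed

end

section \<open>Products of two partial normal subgroups\<close>

context locality begin

lemma S_elt_wprod:
  assumes "P \<in> \<Delta>" "P \<subseteq> word_conj_set L S [g, h]"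
  shows "[g, h] \<in> wdom L" "P \<subseteq> S_elt L S (g \<cdot> h)"
    "conj_set L P (g \<cdot> h) = conj_set L (conj_set L P g) h"
    "x \<in> normalizer_of P \<Longrightarrow> x \<in> conj_dom L (g \<cdot> h) \<and> x \<up> (g \<cdot> h) = x \<up> g \<up> h"
    "X \<subseteq> normalizer_of P \<Longrightarrow> X \<subseteq> conj_dom L (g \<cdot> h) \<and>
      conj_set L X (g \<cdot> h) = conj_set L (conj_set L X g) h"
proof -
  show D: "[g, h] \<in> wdom L" using assms by (rule wdomI)
  show "P \<subseteq> S_elt L S (g \<cdot> h)" using word_conj_set_wprod(1)[OF D] assms by blast
  show "conj_set L P (g \<cdot> h) = conj_set L (conj_set L P g) h"
    using word_conj_set_wprod(2)[OF D] assms(2) by (force simp: conj_set_def)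
  show elt: "x \<in> conj_dom L (g \<cdot> h) \<and> x \<up> (g \<cdot> h) = x \<up> g \<up> h" if "x \<in> normalizer_of P" for x
    using conj_word_wprod(1,2)[OF assms that] by simp
  show "X \<subseteq> conj_dom L (g \<cdot> h) \<and> conj_set L X (g \<cdot> h) = conj_set L (conj_set L X g) h"
    if "X \<subseteq> normalizer_of P"
    using elt that unfolding conj_set_def by (auto simp: subset_iff image_image)
qed

lemma normalizer_Int_S: "R \<in> \<Delta> \<Longrightarrow> pg_subgroup L (normalizer_of R \<inter> S)"
  using pg_subgroup_subset[OF S_subgroup partial_subgroup_Int[OF pg_subgroupD(1)[OF normalizer_subgroup] S_D(1)]]
  by auto

lemma S_obj: "S \<in> \<Delta>"
  using objects_nonempty obj_overgroup[OF _ S_subgroup] obj_subset by blast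

lemma S_elt_conj_S: "P \<subseteq> S_elt L S g \<Longrightarrow> conj_set L P g \<subseteq> S"
  by (auto simp: S_elt_def conj_set_def)

text \<open>If \<open>s\<close> and \<open>m \<in> M\<close>, then \<open>s\<^sup>m\<close> and \<open>s\<close> differ by an element of \<open>M \<inter> S\<close>.\<close>

lemma conj_mem_overgroup_iff:
  assumes M: "partial_normal_subgroup L M" and m: "m \<in> M" and a: "a \<in> S_elt L S m"
    and X: "pg_subgroup L X" "M \<inter> S \<subseteq> X" "X \<subseteq> S"
  shows "a \<up> m \<in> X \<longleftrightarrow> a \<in> X"
proof -
  note M' = partial_subgroupD[OF partial_normalD(1)[OF M]]
  have aS: "a \<in> S" "a \<up> m \<in> S" and D: "[pinv m, a, m] \<in> wdom L"
    using a conj_domD(3) by (auto simp: S_elt_def)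
  have c: "m \<in> carrier L" "pinv m \<in> M" "a \<in> carrier L" using m M' aS S_D by auto
  have "in_coset M (pinv m) \<e>" "in_coset M m \<e>" "in_coset M a a"
    using in_coset_punit_iff in_coset_self[OF partial_normalD(1)[OF M] aS(1)] c m by auto
  moreover have "concat [[pinv m, a], [m]] \<in> wdom L" using D by simp
  from wprod_concat[OF this] have "[pinv m \<cdot> a, m] \<in> wdom L" using c by (simp add: wprod_singleton)
  moreover have "[pinv m, a] \<in> wdom L" using append_wdomD1[of "[pinv m, a]" "[m]"] D by simp
  \<comment> \<open>The factors \<open>m^-1\<close>, \<open>a\<close>, \<open>m\<close> lie in the
    cosets of the unit, \<open>a\<close> and the unit. So \<open>a^m\<close> lies in
    \<open>Ma\<close>, and the quotient of \<open>a^m\<close> by \<open>a\<close> lies in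
    \<open>M \<inter> S\<close>.\<close>
  ultimately have "in_coset M (pinv m \<cdot> a \<cdot> m) (\<e> \<cdot> a \<cdot> \<e>)"
    using in_coset_mult[OF M] by blast
  hence "(a \<up> m) \<cdot> pinv a \<in> M" using c conj_elt_eq[OF D] by (simp add: in_coset_def)
  moreover have "(a \<up> m) \<cdot> pinv a \<in> S" using aS S_D by auto
  ultimately have t: "(a \<up> m) \<cdot> pinv a \<in> X" using X by auto
  interpret group "group_of L S" using S_subgroup by (rule group_group_of)
  have Xs: "subgroup X (group_of L S)" using X subgroup_group_of_iff[OF S_subgroup] by simp
  have inv: "inv\<^bsub>group_of L S\<^esub> x = pinv x" if "x \<in> S" for x using inv_group_of[OF S_subgroup that] .
  have "(a \<up> m) \<cdot> pinv a \<in> X \<longleftrightarrow> (a \<up> m) \<otimes>\<^bsub>group_of L S\<^esub> inv\<^bsub>group_of L S\<^esub> a \<in> X"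
    using inv aS by simp
  with t have t': "(a \<up> m) \<otimes>\<^bsub>group_of L S\<^esub> inv\<^bsub>group_of L S\<^esub> a \<in> X" by simp
  have e: "a \<up> m = ((a \<up> m) \<otimes>\<^bsub>group_of L S\<^esub> inv\<^bsub>group_of L S\<^esub> a) \<otimes>\<^bsub>group_of L S\<^esub> a"
    using aS inv_solve_right[of "(a \<up> m) \<otimes>\<^bsub>group_of L S\<^esub> inv\<^bsub>group_of L S\<^esub> a" "a \<up> m" a] by (simp add: inv S_D)
  have f: "a = inv\<^bsub>group_of L S\<^esub> ((a \<up> m) \<otimes>\<^bsub>group_of L S\<^esub> inv\<^bsub>group_of L S\<^esub> a) \<otimes>\<^bsub>group_of L S\<^esub> (a \<up> m)"
    using aS e inv_solve_left[of a "(a \<up> m) \<otimes>\<^bsub>group_of L S\<^esub> inv\<^bsub>group_of L S\<^esub> a" "a \<up> m"] by (simp add: inv S_D)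
  show ?thesis
  proof
    assume "a \<in> X"
    thus "a \<up> m \<in> X" using subgroup.m_closed[OF Xs t'] e by metis
  next
    assume "a \<up> m \<in> X"
    thus "a \<in> X" using subgroup.m_closed[OF Xs subgroup.m_inv_closed[OF Xs t']] f by metis
  qed
qed

text \<open>Whatever passes through \<open>x\<close> inside \<open>S\<close> also passes through
  \<open>w\<close> inside \<open>S\<close>, so replacing the letter keeps the word in the domain.
  This is the main use of factorizations with \<open>S_g = S_(m,n)\<close>.\<close>

lemma word_expand:
  assumes "u @ [x] @ v \<in> wdom L" "w \<in> wdom L" "wprod L w = x" "S_elt L S x \<subseteq> word_conj_set L S w"
  shows "u @ w @ v \<in> wdom L" "wprod L (u @ w @ v) = wprod L (u @ [x] @ v)"
proof -
  show D: "u @ w @ v \<in> wdom L"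
  proof (rule wdomI[OF word_conj_set_obj[OF assms(1)]], rule subsetI)
    fix a assume "a \<in> word_conj_set L S (u @ [x] @ v)"
    hence a: "a \<in> word_conj_set L S u" "foldl (conj_elt L) a u \<in> S_elt L S x"
      "foldl (conj_elt L) a u \<up> x \<in> word_conj_set L S v"
      by (auto simp: word_conj_set_append)
    moreover have "foldl (conj_elt L) (foldl (conj_elt L) a u) w = foldl (conj_elt L) a u \<up> x"
      using word_conj_set_wprod(2)[OF assms(2), of "foldl (conj_elt L) a u"] a assms(3,4) by auto
    ultimately show "a \<in> word_conj_set L S (u @ w @ v)"
      using assms(4) by (auto simp: word_conj_set_append)
  qed
  show "wprod L (u @ w @ v) = wprod L (u @ [x] @ v)"
    using assoc_wprod[OF D] assms(3) by simp
qed

end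

section \<open>Conjugating p-subgroups into S by elements of the intersection of M and N\<close>

locale two_normal = locality +
  fixes M N
  assumes M: "partial_normal_subgroup L M" and N: "partial_normal_subgroup L N"
begin

lemmas MN_Int = partial_normal_Int[OF M N]
lemmas M_D = partial_subgroupD[OF partial_normalD(1)[OF M]]
lemmas N_D = partial_subgroupD[OF partial_normalD(1)[OF N]]
lemmas K_D = partial_subgroupD[OF partial_normalD(1)[OF MN_Int]]

definition J where "J = S_product M \<inter> S_product N"

lemma J_subgroup: "partial_subgroup L J" "S \<subseteq> J"
  using S_product_subgroup[OF M] S_product_subgroup[OF N] partial_subgroup_Int by (auto simp: J_def)

lemmas KS = S_product_subgroup[OF MN_Int]
lemmas KS_D = partial_subgroupD[OF KS(1)]

lemma KS_J: "S_product (M \<inter> N) \<subseteq> J"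
  using S_product_mono[of "M \<inter> N" M] S_product_mono[of "M \<inter> N" N] by (auto simp: J_def)

lemma normalizer_J: "R \<in> \<Delta> \<Longrightarrow> pg_subgroup L (normalizer_of R \<inter> J)"
  by (rule pg_subgroup_subset[OF normalizer_subgroup])
    (use partial_subgroup_Int[OF pg_subgroupD(1)[OF normalizer_subgroup] J_subgroup(1)] in auto)

text \<open>Inside the normalizer of \<open>R^j\<close> in \<open>J\<close>, Sylow's theorem moves
  \<open>B^j\<close> into \<open>S\<close> by some \<open>i\<close>. By
  \<open>sylow_normalizer_S_product\<close> this \<open>i\<close> lies in
  \<open>(M \<inter> N)S\<close>, and so does \<open>j \<cdot> i\<close>.\<close>

lemma conj_into_S_if_sylow:
  assumes R: "R \<in> \<Delta>" and j: "j \<in> S_product (M \<inter> N)" "R \<subseteq> S_elt L S j"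
    and syl: "sylow_in (normalizer_of (conj_set L R j) \<inter> S) (normalizer_of (conj_set L R j) \<inter> J)"
    and B: "pg_p_subgroup p L B" "B \<subseteq> normalizer_of R \<inter> J"
  shows "\<exists>i\<in>S_product (M \<inter> N). R \<subseteq> S_elt L S i \<and> B \<subseteq> conj_dom L i \<and> conj_set L B i \<subseteq> S"
proof -
  let ?R = "conj_set L R j" and ?B = "conj_set L B j"
  have R': "?R \<in> \<Delta>" using obj_conj[OF R j(2)] .
  have B': "pg_subgroup L B" "B \<subseteq> normalizer_of R" using B by (auto simp: pg_p_subgroup_def)
  note cB = conj_set_normalizer[OF R j(2) B']
  have "?B \<subseteq> J"
    using partial_subgroup_conj[OF J_subgroup(1)] B KS_J j(1) conj_normalizer(1)[OF R j(2)]
    by (auto simp: conj_set_def subset_iff)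
  hence BJ: "?B \<subseteq> normalizer_of ?R \<inter> J" using cB by auto
  have "pg_p_subgroup p L ?B"
    using B cB finite_pg[OF pg_subgroupD(3)[OF cB(1)]] by (auto simp: pg_p_subgroup_def)
  from sylow_in_conj[OF normalizer_J[OF R'] normalizer_Int_S[OF R'] _ syl this BJ] J_subgroup(2)
  obtain i where i: "i \<in> normalizer_of ?R \<inter> J" "?B \<subseteq> conj_dom L i" "conj_set L ?B i \<subseteq> normalizer_of ?R \<inter> S"
    by auto
  have iK: "i \<in> S_product (M \<inter> N)"
    using sylow_normalizer_S_product[OF M N R'] syl i(1) unfolding J_def by blast
  have w: "R \<subseteq> word_conj_set L S [j, i]"
  proof
    fix a assume a: "a \<in> R"
    hence "a \<up> j \<in> ?R" by (auto simp: conj_set_def)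
    moreover have "?R \<subseteq> conj_dom L i" "conj_set L ?R i = ?R" using i(1) by (auto simp: normalizer_of_def)
    ultimately have "a \<up> j \<in> conj_dom L i" "a \<up> j \<up> i \<in> ?R" unfolding conj_set_def by blast+
    thus "a \<in> word_conj_set L S [j, i]" using a j(2) obj_subset[OF R'] by (auto simp: S_elt_def)
  qed
  note W = S_elt_wprod[OF R w]
  have "B \<subseteq> conj_dom L (j \<cdot> i)" "conj_set L B (j \<cdot> i) \<subseteq> S"
    using W(5)[OF B'(2)] i(3) by auto
  moreover have "j \<cdot> i \<in> S_product (M \<inter> N)" using KS_D(5)[OF j(1) iK W(1)] .
  ultimately show ?thesis using W(2) by blast
qed

text \<open>Otherwise \<open>S\<close> would be properly contained in a \<open>p\<close>-subgroup,
  against its maximality.\<close>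

lemma sylow_S: "sylow_in (normalizer_of S \<inter> S) (normalizer_of S \<inter> J)"
proof (rule ccontr)
  assume n: "\<not> ?thesis"
  have e: "normalizer_of S \<inter> S = S" using subgroup_normalizes_self[OF S_subgroup] by auto
  obtain Q where "pg_p_subgroup p L Q" "S \<subset> Q"
    using p_subgroup_grows[OF normalizer_J[OF S_obj] S_p_subgroup _ n[unfolded e]]
      subgroup_normalizes_self[OF S_subgroup] J_subgroup(2) by auto
  thus False using S_maximal by blast
qed

text \<open>Among the conjugates \<open>R^j\<close> one is chosen whose normalizer \<open>R1\<close>
  in \<open>S\<close> has maximal order. If \<open>R1\<close> is not Sylow, it lies properly in a
  \<open>p\<close>-subgroup \<open>Q\<close> of the normalizer of \<open>R^j\<close> in
  \<open>J\<close> that normalizes \<open>R1\<close>. Since \<open>R1\<close> is a larger object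
  than \<open>R\<close>, induction allows \<open>Q\<close> to be conjugated into \<open>S\<close>,
  contradicting maximality.\<close>

lemma ex_sylow_conj:
  assumes "R \<in> \<Delta>"
  shows "\<exists>j\<in>S_product (M \<inter> N). R \<subseteq> S_elt L S j \<and>
    sylow_in (normalizer_of (conj_set L R j) \<inter> S) (normalizer_of (conj_set L R j) \<inter> J)"
  using assms
proof (induction "card S - card R" arbitrary: R rule: less_induct)
  case less
  have RS: "R \<subseteq> S" and Rc: "R \<subseteq> carrier L" using obj_subset[OF less.prems] S_D by auto
  have e1: "\<e> \<in> S_product (M \<inter> N)" "R \<subseteq> S_elt L S \<e>" "conj_set L R \<e> = R"
    using KS_D RS Rc by (auto simp: S_elt_def conj_set_def subset_iff)
  show ?case
  proof (cases "R = S")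
    case True
    thus ?thesis using e1 sylow_S by metis
  next
    case False
    let ?P = "\<lambda>j. j \<in> S_product (M \<inter> N) \<and> R \<subseteq> S_elt L S j"
    let ?f = "\<lambda>j. card (normalizer_of (conj_set L R j) \<inter> S)"
    have "\<exists>j. ?P j \<and> (\<forall>i. ?P i \<longrightarrow> ?f i \<le> ?f j)"
    proof (rule ex_has_greatest_nat[of ?P \<e> ?f "Suc (card S)"])
      show "\<forall>y. ?P y \<longrightarrow> ?f y < Suc (card S)" using card_mono[OF finite_S] by (simp add: less_Suc_eq_le)
    qed (use e1 in simp)
    then obtain j where j: "j \<in> S_product (M \<inter> N)" "R \<subseteq> S_elt L S j"
      and max: "\<And>i. ?P i \<Longrightarrow> ?f i \<le> ?f j" by auto
    let ?R = "conj_set L R j"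
    define R1 where "R1 = normalizer_of ?R \<inter> S"
    have R': "?R \<in> \<Delta>" using obj_conj[OF less.prems j(2)] .
    have "R \<subseteq> conj_dom L j" using j(2) by (auto simp: S_elt_def)
    hence cR: "card ?R = card R" by (rule card_conj_set)
    have "sylow_in R1 (normalizer_of ?R \<inter> J)"
    proof (rule ccontr)
      assume n: "\<not> ?thesis"
      have R1: "pg_subgroup L R1" "R1 \<subseteq> S" using normalizer_Int_S[OF R'] by (auto simp: R1_def)
      have R1J: "R1 \<subseteq> normalizer_of ?R \<inter> J" using J_subgroup(2) by (auto simp: R1_def)
      obtain Q where Q: "pg_p_subgroup p L Q" "R1 \<subset> Q" "Q \<subseteq> normalizer_of ?R \<inter> J" "Q \<subseteq> normalizer_of R1"
        using p_subgroup_grows[OF normalizer_J[OF R'] p_subgroup_S[OF R1] R1J n] by auto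
      have "card R < card S" using False RS finite_S by (simp add: psubset_card_mono psubsetI)
      hence "?R \<subset> S" using cR obj_subset[OF R'] by auto
      \<comment> \<open>Normalizers grow in \<open>S\<close>, so \<open>R1\<close> properly contains
        \<open>R^j\<close>; this makes the induction measure drop.\<close>
      then obtain A where A: "?R \<subset> A" "A \<subseteq> S" "A \<subseteq> normalizer_of ?R"
        using S_subgroup_grows[OF S_subgroup subset_refl obj_subgroup[OF R']] by auto
      hence RR1: "?R \<subset> R1" by (auto simp: R1_def)
      hence R1o: "R1 \<in> \<Delta>" using obj_overgroup[OF R' R1] by auto
      have finR1: "finite R1" using R1 finite_S finite_subset by auto
      have "card R < card R1" using psubset_card_mono[OF finR1 RR1] cR by simp
      moreover have "card R1 \<le> card S" using R1 finite_S card_mono by auto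
      ultimately have lt: "card S - card R1 < card S - card R" by simp
      obtain j1 where j1: "j1 \<in> S_product (M \<inter> N)" "R1 \<subseteq> S_elt L S j1"
        "sylow_in (normalizer_of (conj_set L R1 j1) \<inter> S) (normalizer_of (conj_set L R1 j1) \<inter> J)"
        using less.hyps[OF lt R1o] by auto
      obtain i where i: "i \<in> S_product (M \<inter> N)" "R1 \<subseteq> S_elt L S i" "Q \<subseteq> conj_dom L i" "conj_set L Q i \<subseteq> S"
        using conj_into_S_if_sylow[OF R1o j1 Q(1)] Q by auto
      have Ri: "?R \<subseteq> S_elt L S i" using RR1 i by auto
      have w: "R \<subseteq> word_conj_set L S [j, i]"
        using j(2) Ri by (auto simp: S_elt_def conj_set_def)
      note W = S_elt_wprod[OF less.prems w]
      have ji: "?P (j \<cdot> i)" using KS_D(5)[OF j(1) i(1) W(1)] W(2) by simp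
      have Q': "pg_subgroup L Q" "Q \<subseteq> normalizer_of ?R" using Q by (auto simp: pg_p_subgroup_def)
      note cQ = conj_set_normalizer[OF R' Ri Q']
      \<comment> \<open>As \<open>Q\<close> normalizes \<open>R^j\<close>, its conjugate lies in the
        normalizer of \<open>R^(ji)\<close> in \<open>S\<close> and has more than
        \<open>card R1\<close> elements.\<close>
      have "conj_set L Q i \<subseteq> normalizer_of (conj_set L R (j \<cdot> i)) \<inter> S"
        using cQ i(4) W(3) by simp
      hence "card (conj_set L Q i) \<le> ?f (j \<cdot> i)" using finite_S by (intro card_mono) auto
      moreover have "card R1 < card Q"
        using Q(1,2) by (intro psubset_card_mono) (auto simp: pg_p_subgroup_def)
      ultimately show False using max[OF ji] cQ(3) by (simp add: R1_def)
    qed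
    thus ?thesis using j by (auto simp: R1_def)
  qed
qed

text \<open>A conjugating element of \<open>(M \<inter> N)S\<close> is multiplied by the inverse of
  its representative \<open>s\<close>. The result lies in \<open>M \<inter> N\<close> and still
  conjugates into \<open>S\<close>, since \<open>s\<close> normalizes \<open>S\<close>.\<close>

lemma p_subgroup_conj_into_S:
  assumes R: "R \<in> \<Delta>" and B: "pg_p_subgroup p L B" "B \<subseteq> normalizer_of R" "B \<subseteq> S_product M" "B \<subseteq> S_product N"
  shows "\<exists>k\<in>M \<inter> N. R \<subseteq> S_elt L S k \<and> B \<subseteq> conj_dom L k \<and> conj_set L B k \<subseteq> S"
proof -
  have BJ: "B \<subseteq> normalizer_of R \<inter> J" using B by (auto simp: J_def)
  obtain j0 where j0: "j0 \<in> S_product (M \<inter> N)" "R \<subseteq> S_elt L S j0"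
    "sylow_in (normalizer_of (conj_set L R j0) \<inter> S) (normalizer_of (conj_set L R j0) \<inter> J)"
    using ex_sylow_conj[OF R] by auto
  obtain j where j: "j \<in> S_product (M \<inter> N)" "R \<subseteq> S_elt L S j" "B \<subseteq> conj_dom L j" "conj_set L B j \<subseteq> S"
    using conj_into_S_if_sylow[OF R j0 B(1) BJ] by auto
  then obtain s where s: "s \<in> S" "j \<cdot> pinv s \<in> M \<inter> N" by (auto simp: S_product_def in_coset_def)
  have s': "pinv s \<in> S" using s S_D by auto
  have w: "R \<subseteq> word_conj_set L S [j, pinv s]"
    using j(2) S_conj[OF s'] by (auto simp: S_elt_def)
  note W = S_elt_wprod[OF R w]
  have "B \<subseteq> conj_dom L (j \<cdot> pinv s)" "conj_set L B (j \<cdot> pinv s) \<subseteq> S"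
    using W(5)[OF B(2)] S_elt_conj_S[of "conj_set L B j" "pinv s"] j(4) S_conj(1)[OF s'] by auto
  thus ?thesis using s W(2) by blast
qed

section \<open>Factorizations that realize conjugation inside S\<close>

lemma conj_p_subgroup:
  assumes P: "P \<in> \<Delta>" "P \<subseteq> S_elt L S g" and A: "pg_subgroup L A" "A \<subseteq> S" "A \<subseteq> normalizer_of P"
  shows "pg_p_subgroup p L (conj_set L A g)"
  using conj_set_normalizer[OF P A(1,3)] p_subgroup_S[OF A(1,2)] 
    finite_pg[OF pg_subgroupD(3)[OF conj_set_normalizer(1)[OF P A(1,3)]]]
  by (auto simp: pg_p_subgroup_def)

text \<open>An element \<open>k\<close> of \<open>M \<inter> N\<close> that moves \<open>A^m\<close>
  into \<open>S\<close> can be shifted from one factor to the other without changing the product or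
  leaving \<open>M\<close> and \<open>N\<close>.\<close>

lemma factorization_increase:
  assumes mn: "m \<in> M" "n \<in> N" "[m, n] \<in> wdom L" and ne: "word_conj_set L S [m, n] \<noteq> S_elt L S (m \<cdot> n)"
  shows "\<exists>m'\<in>M. \<exists>n'\<in>N. [m', n'] \<in> wdom L \<and> m' \<cdot> n' = m \<cdot> n \<and>
    word_conj_set L S [m, n] \<subset> word_conj_set L S [m', n']"
proof -
  define P where "P = word_conj_set L S [m, n]"
  let ?g = "m \<cdot> n" and ?R = "conj_set L P m"
  have P: "P \<in> \<Delta>" unfolding P_def using word_conj_set_obj[OF mn(3)] .
  have mnc: "m \<in> carrier L" "n \<in> carrier L" using mn M_D N_D by auto
  note W = S_elt_wprod[OF P, of m n, unfolded P_def[symmetric], OF subset_refl]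
  have Pm: "P \<subseteq> S_elt L S m" and Rn: "?R \<subseteq> S_elt L S n" by (auto simp: P_def conj_set_def)
  have R: "?R \<in> \<Delta>" using obj_conj[OF P Pm] .
  have "P \<subset> S_elt L S ?g" using W(2) ne by (auto simp: P_def)
  then obtain A where A: "pg_subgroup L A" "P \<subset> A" "A \<subseteq> S_elt L S ?g" "A \<subseteq> normalizer_of P"
    using S_subgroup_grows[OF S_elt_subgroup S_elt_subset obj_subgroup[OF P]] wprod_closed[OF mn(3)]
    by blast
  have AS: "A \<subseteq> S" using A(3) S_elt_subset by blast
  note cA = conj_set_normalizer[OF P Pm A(1,4)]
  let ?B = "conj_set L A m"
  have an: "a \<up> m \<in> conj_dom L n" "a \<up> m \<up> n = a \<up> ?g" "a \<up> ?g \<in> S" "a \<in> conj_dom L m" if a: "a \<in> A" for a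
    using conj_normalizer[OF P Pm, of a] conj_normalizer(1)[OF R Rn, of "a \<up> m"] W(4)[of a] A a
    by (auto simp: S_elt_def)
  have BM: "?B \<subseteq> S_product M"
    using partial_subgroup_conj[OF S_product_subgroup(1)[OF M]] S_product_subgroup(2,3)[OF M] AS an(4) mn(1)
    by (auto simp: conj_set_def subset_iff)
  \<comment> \<open>Seen from the other end, \<open>a^m\<close> is the conjugate of the element
    \<open>a^g\<close> of \<open>S\<close> by \<open>n^-1\<close>.\<close>
  have "a \<up> m \<in> S_product N" if a: "a \<in> A" for a
    using conj_pinv[OF an(1)[OF a]] an(2,3)[OF a] S_product_subgroup(2,3)[OF N] N_D(2)[OF mn(2)]
      partial_subgroup_conj[OF S_product_subgroup(1)[OF N], of "a \<up> ?g" "pinv n"] by auto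
  hence BN: "?B \<subseteq> S_product N" by (auto simp: conj_set_def)
  obtain k where k: "k \<in> M \<inter> N" "?R \<subseteq> S_elt L S k" "?B \<subseteq> conj_dom L k" "conj_set L ?B k \<subseteq> S"
    using p_subgroup_conj_into_S[OF R conj_p_subgroup[OF P Pm A(1) AS A(4)] cA(2) BM BN] by auto
  have kc: "k \<in> carrier L" using k K_D by auto
  have undo: "x \<up> k \<in> S_elt L S (pinv k)" "x \<up> k \<up> pinv k = x" if "x \<in> ?R" for x
    using conj_pinv[of x k] k(2) that by (auto simp: S_elt_def subset_iff)
  have Pmk: "P \<subseteq> word_conj_set L S [m, k]" using Pm k(2) by (auto simp: S_elt_def conj_set_def)
  have Rk: "conj_set L ?R k \<subseteq> word_conj_set L S [pinv k, n]"
    using undo Rn by (auto simp: conj_set_def S_elt_def)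
  \<comment> \<open>The object \<open>P\<close> already guarantees that \<open>k k^-1\<close> may be
    inserted between \<open>m\<close> and \<open>n\<close>.\<close>
  have "P \<subseteq> word_conj_set L S [m, k, pinv k, n]"
    using Pmk Rk by (auto simp: conj_set_def)
  hence D: "[m, k, pinv k, n] \<in> wdom L" using wdomI[OF P] by simp
  define m' n' where "m' = m \<cdot> k" and "n' = pinv k \<cdot> n"
  have "concat [[m, k], [pinv k, n]] \<in> wdom L" using D by simp
  from wprod_concat[OF this] have D': "[m', n'] \<in> wdom L" "m' \<cdot> n' = wprod L [m, k, pinv k, n]"
    by (simp_all add: m'_def n'_def)
  have D1: "concat [[m], [k, pinv k], [n]] \<in> wdom L" using D by simp
  have "wprod L [m, \<e>, n] = wprod L [m, k, pinv k, n]" and D2: "concat [[m, \<e>], [n]] \<in> wdom L"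
    using wprod_concat[OF D1] mnc kc by (simp_all add: wprod_singleton)
  hence e: "m' \<cdot> n' = m \<cdot> n" using wprod_concat(2)[OF D2] mnc D' by (simp add: wprod_singleton)
  note W1 = S_elt_wprod[OF P Pmk] and W2 = S_elt_wprod[OF obj_conj[OF R k(2)] Rk]
  have mem: "m' \<in> M" "n' \<in> N"
    using M_D(5)[OF mn(1) _ W1(1)] N_D(5)[OF _ mn(2) W2(1)] N_D(2)[of k] k(1) by (auto simp: m'_def n'_def)
  \<comment> \<open>Although \<open>a^m\<close> need not lie in \<open>S\<close>, conjugation of
    \<open>a\<close> along \<open>(m, k)\<close> and then \<open>(k^-1, n)\<close> is defined
    because \<open>a\<close> normalizes \<open>P\<close>. Only the value after \<open>k\<close> has
    to lie in \<open>S\<close>.\<close>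
  have AW: "A \<subseteq> word_conj_set L S [m', n']"
  proof
    fix a assume a: "a \<in> A"
    hence aP: "a \<in> normalizer_of P" using A by auto
    have aB: "a \<up> m \<in> conj_dom L k" "a \<up> m \<up> k \<in> S" using k(3,4) a by (auto simp: conj_set_def)
    have 1: "a \<in> conj_dom L m'" "a \<up> m' = a \<up> m \<up> k"
      using W1(4)[OF aP] by (auto simp: m'_def)
    have "a \<up> m \<up> k \<in> normalizer_of (conj_set L ?R k)"
      using conj_normalizer(2)[OF R k(2)] conj_normalizer(2)[OF P Pm aP] by auto
    from W2(4)[OF this] have 2: "a \<up> m' \<in> conj_dom L n'" "a \<up> m' \<up> n' = a \<up> m \<up> k \<up> pinv k \<up> n"
      using 1 by (auto simp: n'_def)
    have "a \<up> m' \<up> n' = a \<up> ?g" using 2 conj_pinv(2)[OF aB(1)] an(2)[OF a] by simp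
    thus "a \<in> word_conj_set L S [m', n']"
      using 1 2 aB an(3)[OF a] a AS by (auto simp: S_elt_def)
  qed
  have "word_conj_set L S [m, n] \<subset> word_conj_set L S [m', n']"
    using A(2) AW unfolding P_def by (rule psubset_subset_trans)
  thus ?thesis using mem D'(1) e by blast
qed

text \<open>Each increase enlarges a subset of the finite set \<open>S\<close>, so induction on the
  number of missing elements ends with equality.\<close>

lemma ex_factorization:
  assumes "m \<in> M" "n \<in> N" "[m, n] \<in> wdom L"
  shows "\<exists>m'\<in>M. \<exists>n'\<in>N. [m', n'] \<in> wdom L \<and> m' \<cdot> n' = m \<cdot> n \<and> S_elt L S (m \<cdot> n) = word_conj_set L S [m', n']"
  using assms
proof (induction "card S - card (word_conj_set L S [m, n])" arbitrary: m n rule: less_induct)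
  case less
  show ?case
  proof (cases "word_conj_set L S [m, n] = S_elt L S (m \<cdot> n)")
    case True
    then show ?thesis using less.prems by metis
  next
    case False
    then obtain m' n' where *: "m' \<in> M" "n' \<in> N" "[m', n'] \<in> wdom L" "m' \<cdot> n' = m \<cdot> n"
      "word_conj_set L S [m, n] \<subset> word_conj_set L S [m', n']"
      using factorization_increase[OF less.prems] by blast
    have "finite (word_conj_set L S [m', n'])" "card (word_conj_set L S [m', n']) \<le> card S"
      using word_conj_set_subset finite_S by (metis finite_subset, metis card_mono)
    hence "card S - card (word_conj_set L S [m', n']) < card S - card (word_conj_set L S [m, n])"
      using psubset_card_mono[OF _ *(5)] by simp
    from less.hyps[OF this *(1-3)] show ?thesis using *(4) by simp
  qed
qed

text \<open>With \<open>N\<close> the whole locality this is the Frattini argument for \<open>M\<close>.\<close>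

lemma frattini_factorization:
  assumes "n \<in> N" "P \<in> \<Delta>" "P \<subseteq> S_elt L S n"
  shows "\<exists>h\<in>N. \<exists>k\<in>M \<inter> N. [h, k] \<in> wdom L \<and> n = h \<cdot> k \<and> P \<subseteq> word_conj_set L S [h, k] \<and> M \<inter> S \<subseteq> S_elt L S h"
  using assms
proof (induction "card S - card P" arbitrary: P n rule: less_induct)
  case less
  note n = less.prems(1) and P = less.prems(2,3)
  have nc: "n \<in> carrier L" using n N_D by auto
  have PS: "pg_subgroup L P" "P \<subseteq> S" using obj_subgroup[OF P(1)] obj_subset[OF P(1)] by auto
  note PD = pg_subgroupD[OF PS(1)]
  show ?case
  proof (cases "M \<inter> S \<subseteq> P")
    case True
    have "P \<subseteq> word_conj_set L S [n, \<e>]"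
      using P(2) S_D by (auto simp: S_elt_def subset_iff)
    thus ?thesis using n nc True P(2) K_D(4) by (intro bexI[of _ n] bexI[of _ \<e>]) auto
  next
    case False
    \<comment> \<open>This is \<open>(M \<inter> S)P\<close>. Growing \<open>P\<close> inside
      \<open>U\<close> enlarges it by elements lying in cosets \<open>Mx\<close> with
      \<open>x\<close> in \<open>P\<close>.\<close>
    define U where "U = {a \<in> S. \<exists>x\<in>P. in_coset M a x}"
    have "partial_subgroup L U"
    proof (rule partial_subgroupI)
      have "\<e> \<in> U" using S_D PD in_coset_self[OF partial_normalD(1)[OF M], of \<e>] by (auto simp: U_def)
      thus "U \<noteq> {}" by auto
      show "U \<subseteq> carrier L" using S_D by (auto simp: U_def)
      show "pinv h \<in> U" if "h \<in> U" for h
      proof -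
        obtain x where x: "x \<in> P" "in_coset M h x" using \<open>h \<in> U\<close> by (auto simp: U_def)
        have "h \<in> S" using \<open>h \<in> U\<close> by (auto simp: U_def)
        thus ?thesis using in_coset_pinv[OF M x(2)] PD(4)[OF x(1)] S_D(4) by (auto simp: U_def)
      qed
      show "x \<cdot> y \<in> U" if xy: "x \<in> U" "y \<in> U" "[x, y] \<in> wdom L" for x y
      proof -
        obtain s t where st: "s \<in> P" "t \<in> P" "in_coset M x s" "in_coset M y t" using xy by (auto simp: U_def)
        thus ?thesis using in_coset_mult[OF M st(3,4) xy(3)] PD(6) xy S_D(6) by (auto simp: U_def)
      qed
    qed
    hence U: "pg_subgroup L U" "U \<subseteq> S" using pg_subgroup_subset[OF S_subgroup] by (auto simp: U_def)
    have "P \<subseteq> U" using in_coset_self[OF partial_normalD(1)[OF M]] PS by (auto simp: U_def)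
    moreover have "M \<inter> S \<subseteq> U" using in_coset_punit_iff PD(5) M_D by (auto simp: U_def)
    ultimately have "P \<subset> U" using False by auto
    then obtain A where A: "pg_subgroup L A" "P \<subset> A" "A \<subseteq> U" "A \<subseteq> normalizer_of P"
      using S_subgroup_grows[OF U PS(1)] by auto
    have AS: "A \<subseteq> S" using A U by auto
    let ?R = "conj_set L P n" and ?B = "conj_set L A n"
    have R: "?R \<in> \<Delta>" using obj_conj[OF P] .
    note cA = conj_set_normalizer[OF P A(1,4)]
    have Pn: "P \<subseteq> normalizer_of P" using subgroup_normalizes_self[OF PS(1)] .
    have BN: "?B \<subseteq> S_product N"
      using partial_subgroup_conj[OF S_product_subgroup(1)[OF N]] S_product_subgroup(2,3)[OF N] AS
        conj_normalizer(1)[OF P] A(4) n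
      by (auto simp: conj_set_def subset_iff)
    \<comment> \<open>Conjugation by \<open>n\<close> is multiplicative on the normalizer of
      \<open>P\<close>, so \<open>a\<close> in \<open>Mx\<close> implies that \<open>a^n\<close>
      lies in \<open>M(x^n)\<close>, where \<open>x^n\<close> is in \<open>S\<close>.\<close>
    have "a \<up> n \<in> S_product M" if a: "a \<in> A" for a
    proof -
      obtain x where x: "x \<in> P" "in_coset M a x" using a A(3) unfolding U_def by blast
      have xn: "x \<in> S_elt L S n" using x P by auto
      have px: "pinv x \<in> normalizer_of P" using Pn PD(4)[OF x(1)] by auto
      have an: "a \<in> normalizer_of P" using a A by auto
      note h = conj_normalizer_mult[OF P an px]
      have "(a \<cdot> pinv x) \<up> n \<in> M"
        using partial_normalD(2)[OF M] conj_mult(2)[OF h(2)] x by (auto simp: in_coset_def)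
      hence "(a \<up> n) \<cdot> pinv (x \<up> n) \<in> M" using h(1) S_elt_pinv(2)[OF xn] by simp
      hence "in_coset M (a \<up> n) (x \<up> n)"
        using xn conj_domD(4)[OF conj_normalizer(1)[OF P an]] by (auto simp: in_coset_def S_elt_def)
      thus ?thesis by (auto simp: S_product_def)
    qed
    hence BM: "?B \<subseteq> S_product M" by (auto simp: conj_set_def)
    obtain k0 where k0: "k0 \<in> M \<inter> N" "?R \<subseteq> S_elt L S k0" "?B \<subseteq> conj_dom L k0" "conj_set L ?B k0 \<subseteq> S"
      using p_subgroup_conj_into_S[OF R conj_p_subgroup[OF P A(1) AS A(4)] cA(2) BM BN] by auto
    have k0c: "k0 \<in> carrier L" using k0 K_D by auto
    have Pw: "P \<subseteq> word_conj_set L S [n, k0]" using P(2) k0(2) by (auto simp: S_elt_def conj_set_def)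
    note W = S_elt_wprod[OF P(1) Pw]
    have n': "n \<cdot> k0 \<in> N" using N_D(5)[OF n _ W(1)] k0 by auto
    have An': "A \<subseteq> S_elt L S (n \<cdot> k0)"
    proof
      fix a assume a: "a \<in> A"
      hence "a \<up> n \<up> k0 \<in> S" using k0(4) unfolding conj_set_def by blast
      thus "a \<in> S_elt L S (n \<cdot> k0)" using a W(4)[of a] A(4) AS by (auto simp: S_elt_def)
    qed
    have Ao: "A \<in> \<Delta>" using obj_overgroup[OF P(1) A(1) AS] A(2) by auto
    have "finite A" using AS finite_S finite_subset by auto
    hence "card P < card A" "card A \<le> card S" 
      using psubset_card_mono[OF _ A(2)] card_mono[OF finite_S AS] by simp_all
    hence "card S - card A < card S - card P" by simp
    \<comment> \<open>The modified element \<open>n \<cdot> k0\<close> conjugates the larger object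
      \<open>A\<close> into \<open>S\<close>, so the induction hypothesis applies to this
      pair.\<close>
    from less.hyps[OF this n' Ao An'] obtain h k where hk: "h \<in> N" "k \<in> M \<inter> N" "[h, k] \<in> wdom L"
      "n \<cdot> k0 = h \<cdot> k" "A \<subseteq> word_conj_set L S [h, k]" "M \<inter> S \<subseteq> S_elt L S h" by auto
    have hkc: "h \<in> carrier L" "k \<in> carrier L" using hk N_D K_D by auto
    \<comment> \<open>On \<open>P\<close>, the word \<open>(h, k)\<close> acts as \<open>n\<close>
      followed by \<open>k0\<close>. Hence \<open>k0^-1\<close> leads back to \<open>P^n\<close>,
      and it can be absorbed into the second factor.\<close>
    have Phk: "P \<subseteq> word_conj_set L S [h, k, pinv k0]"
    proof
      fix a assume a: "a \<in> P"
      hence a1: "a \<in> word_conj_set L S [h, k]" using hk A by auto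
      have "a \<up> h \<up> k = a \<up> n \<up> k0"
        using word_conj_set_wprod(2)[OF hk(3) a1] W(4)[of a] Pn a hk(4) by auto
      moreover have "a \<up> n \<in> S_elt L S k0" using a k0(2) by (auto simp: conj_set_def)
      hence "a \<up> n \<up> k0 \<in> S_elt L S (pinv k0)"
        using conj_pinv[of "a \<up> n" k0] by (auto simp: S_elt_def)
      ultimately show "a \<in> word_conj_set L S [h, k, pinv k0]" using a1 by (auto simp: S_elt_def)
    qed
    have D: "[h, k, pinv k0] \<in> wdom L" using wdomI[OF P(1) Phk] .
    have Dk: "[k, pinv k0] \<in> wdom L" using append_wdomD2[of "[h]" "[k, pinv k0]"] D by simp
    have "concat [[h], [k, pinv k0]] \<in> wdom L" "concat [[h, k], [pinv k0]] \<in> wdom L" using D by simp_all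
    note D12 = wprod_concat[OF this(1)] wprod_concat[OF this(2)]
    have c1: "[h, k \<cdot> pinv k0] \<in> wdom L" "h \<cdot> (k \<cdot> pinv k0) = (h \<cdot> k) \<cdot> pinv k0"
      using D12 hkc k0c by (simp_all add: wprod_singleton)
    have "[n, k0, pinv k0] \<in> wdom L" "wprod L [n, k0, pinv k0] = n"
      using cancel_right[of "[n]" "[k0]"] W(1) nc by (simp_all add: wprod_singleton)
    hence "(n \<cdot> k0) \<cdot> pinv k0 = n"
      using assoc_wprod[of "[]" "[n, k0]" "[pinv k0]"] by simp
    hence c2: "n = h \<cdot> (k \<cdot> pinv k0)" using c1 hk(4) by simp
    have c3: "k \<cdot> pinv k0 \<in> M \<inter> N" using K_D(5)[OF hk(2) _ Dk] K_D(2) k0 by blast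
    have "P \<subseteq> word_conj_set L S [h, k \<cdot> pinv k0]"
    proof
      fix a assume "a \<in> P"
      hence "a \<in> S_elt L S h" "a \<up> h \<in> word_conj_set L S [k, pinv k0]" using Phk by auto
      thus "a \<in> word_conj_set L S [h, k \<cdot> pinv k0]"
        using word_conj_set_wprod(1)[OF Dk] by (auto simp: S_elt_def)
    qed
    thus ?thesis using hk(1,6) c1(1) c2 c3 by blast
  qed
qed

text \<open>With \<open>n = hk\<close> from the Frattini factorization,
  \<open>mn = h (m^h k)\<close>, where \<open>k\<close> lies in \<open>M\<close> as well.\<close>

lemma set_mult_commute_subset: "pg_set_mult L M N \<subseteq> pg_set_mult L N M"
proof
  fix g assume "g \<in> pg_set_mult L M N"
  then obtain m n where mn: "m \<in> M" "n \<in> N" "[m, n] \<in> wdom L" "g = m \<cdot> n" by (auto simp: pg_set_mult_def)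
  have c: "m \<in> carrier L" "n \<in> carrier L" using mn M_D N_D by auto
  obtain h k where hk: "h \<in> N" "k \<in> M \<inter> N" "[h, k] \<in> wdom L" "n = h \<cdot> k"
    "S_elt L S n \<subseteq> word_conj_set L S [h, k]" "M \<inter> S \<subseteq> S_elt L S h"
    using frattini_factorization[OF mn(2) S_elt_obj[OF c(2)] subset_refl] by blast
  have hkc: "h \<in> carrier L" "k \<in> carrier L" using hk N_D K_D by auto
  let ?w = "[h, pinv h, m, h, k]"
  have D: "?w \<in> wdom L"
  proof (rule wdomI[OF word_conj_set_obj[OF mn(3)]], rule subsetI)
    fix a assume "a \<in> word_conj_set L S [m, n]"
    hence a: "a \<in> S_elt L S m" "a \<up> m \<in> word_conj_set L S [h, k]" "a \<in> S" using hk(5) by (auto simp: S_elt_def)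
    \<comment> \<open>Since \<open>S_h\<close> contains \<open>M \<inter> S\<close>, conjugation by
      \<open>m\<close> does not change membership in it. This allows \<open>h h^-1\<close> to be
      inserted in front of \<open>m\<close>.\<close>
    hence "a \<in> S_elt L S h"
      using conj_mem_overgroup_iff[OF M mn(1) a(1) S_elt_subgroup[OF hkc(1)] hk(6) S_elt_subset] by auto
    thus "a \<in> word_conj_set L S ?w"
      using a conj_pinv[of a h] by (auto simp: S_elt_def)
  qed
  have "concat [[h], [pinv h, m, h], [k]] \<in> wdom L" using D by simp
  from wprod_concat[OF this] have 1: "concat [[h], [m \<up> h, k]] \<in> wdom L" "wprod L [h, m \<up> h, k] = wprod L ?w"
    using hkc by (simp_all add: wprod_singleton conj_elt_def)
  from wprod_concat[OF 1(1)] have 2: "[h, (m \<up> h) \<cdot> k] \<in> wdom L" "h \<cdot> ((m \<up> h) \<cdot> k) = wprod L ?w"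
    using hkc 1(2) by (simp_all add: wprod_singleton)
  have "[pinv h, m, h] \<in> wdom L" using append_wdomD1[of "[pinv h, m, h]" "[k]"] append_wdomD2[of "[h]" "[pinv h, m, h, k]"] D by simp
  hence "m \<up> h \<in> M" using partial_normalD(2)[OF M mn(1) conj_domI] by simp
  moreover have "[m \<up> h, k] \<in> wdom L" using append_wdomD2[of "[h]" "[m \<up> h, k]"] 1(1) by simp
  ultimately have "(m \<up> h) \<cdot> k \<in> M" using M_D(5) hk(2) by auto
  moreover have "concat [[h, pinv h], [m], [h, k]] \<in> wdom L" using D by simp
  from wprod_concat[OF this] have 3: "concat [[\<e>, m], [n]] \<in> wdom L" "wprod L [\<e>, m, n] = wprod L ?w"
    using hkc c hk(4) by (simp_all add: wprod_singleton)
  have "m \<cdot> n = wprod L ?w" using wprod_concat(2)[OF 3(1)] 3(2) c by (simp add: wprod_singleton)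
  ultimately show "g \<in> pg_set_mult L N M" using hk(1) 2 mn(4) unfolding pg_set_mult_def by force
qed

end

section \<open>The product MN: closure, normality and intersection with S\<close>

sublocale two_normal \<subseteq> swap: two_normal p L \<Delta> S N M
  by unfold_locales (rule N, rule M)

context two_normal begin

lemma set_mult_commute: "pg_set_mult L M N = pg_set_mult L N M"
  using set_mult_commute_subset swap.set_mult_commute_subset by auto

lemma set_multI: "m \<in> M \<Longrightarrow> n \<in> N \<Longrightarrow> [m, n] \<in> wdom L \<Longrightarrow> m \<cdot> n \<in> pg_set_mult L M N"
  by (auto simp: pg_set_mult_def)

lemma set_multE:
  assumes "g \<in> pg_set_mult L M N"
  obtains m n where "m \<in> M" "n \<in> N" "[m, n] \<in> wdom L" "m \<cdot> n = g" "S_elt L S g = word_conj_set L S [m, n]"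
proof -
  obtain m n where "m \<in> M" "n \<in> N" "[m, n] \<in> wdom L" "g = m \<cdot> n" using assms by (auto simp: pg_set_mult_def)
  with ex_factorization[OF this(1-3)] that show thesis by metis
qed

lemma set_mult_superset: "M \<subseteq> pg_set_mult L M N" "N \<subseteq> pg_set_mult L M N"
proof -
  show "M \<subseteq> pg_set_mult L M N" using set_multI[of _ \<e>] N_D(4) M_D(1) by fastforce
  show "N \<subseteq> pg_set_mult L M N" using set_multI[of \<e>] M_D(4) N_D(1) by fastforce
qed

text \<open>Factorizations with \<open>S_x = S_(m1,n1)\<close> and \<open>S_y = S_(m2,n2)\<close>
  expand \<open>xy\<close> to \<open>m1 n1 m2 n2\<close>. The middle pair lies in
  \<open>NM = MN\<close> and is rewritten as \<open>m3 n3\<close>, giving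
  \<open>(m1 m3)(n3 n2)\<close>.\<close>

lemma set_mult_mult:
  assumes x: "x \<in> pg_set_mult L M N" and y: "y \<in> pg_set_mult L M N" and xy: "[x, y] \<in> wdom L"
  shows "x \<cdot> y \<in> pg_set_mult L M N"
proof -
  obtain m1 n1 where 1: "m1 \<in> M" "n1 \<in> N" "[m1, n1] \<in> wdom L" "m1 \<cdot> n1 = x" "S_elt L S x = word_conj_set L S [m1, n1]"
    using set_multE[OF x] .
  obtain m2 n2 where 2: "m2 \<in> M" "n2 \<in> N" "[m2, n2] \<in> wdom L" "m2 \<cdot> n2 = y" "S_elt L S y = word_conj_set L S [m2, n2]"
    using set_multE[OF y] .
  have "[] @ [x] @ [y] \<in> wdom L" using xy by simp
  from word_expand[OF this 1(3,4)] 1(5) 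
  have "[m1, n1] @ [y] @ [] \<in> wdom L" "wprod L [m1, n1, y] = x \<cdot> y" by simp_all
  from word_expand[OF this(1) 2(3,4)] 2(5) this(2)
  have D: "[m1] @ [n1, m2] @ [n2] \<in> wdom L" and e: "wprod L [m1, n1, m2, n2] = x \<cdot> y" by simp_all
  have "[n1, m2] \<in> wdom L" using append_wdomD1[OF append_wdomD2[OF D]] .
  hence "n1 \<cdot> m2 \<in> pg_set_mult L M N" using 1 2 unfolding set_mult_commute by (auto simp: pg_set_mult_def)
  then obtain m3 n3 where 3: "m3 \<in> M" "n3 \<in> N" "[m3, n3] \<in> wdom L" "m3 \<cdot> n3 = n1 \<cdot> m2"
    "S_elt L S (n1 \<cdot> m2) = word_conj_set L S [m3, n3]" using set_multE by metis
  from word_expand[OF assoc_wdom[OF D] 3(3,4)] 3(5) assoc_wprod[OF D] e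
  have D': "concat [[m1, m3], [n3, n2]] \<in> wdom L" and e': "wprod L [m1, m3, n3, n2] = x \<cdot> y" by simp_all
  have "m1 \<cdot> m3 \<in> M" using append_wdomD1[of "[m1, m3]" "[n3, n2]"] D' M_D(5) 1 3 by simp
  moreover have "n3 \<cdot> n2 \<in> N" using append_wdomD2[of "[m1, m3]" "[n3, n2]"] D' N_D(5) 2 3 by simp
  ultimately show ?thesis using wprod_concat[OF D'] e' set_multI by fastforce
qed

lemma set_mult_partial_subgroup: "partial_subgroup L (pg_set_mult L M N)"
proof (rule partial_subgroupI)
  show "pg_set_mult L M N \<noteq> {}" using set_mult_superset M_D by auto
  show "pg_set_mult L M N \<subseteq> carrier L" by (auto simp: pg_set_mult_def wprod_closed)
  show "pinv g \<in> pg_set_mult L M N" if "g \<in> pg_set_mult L M N" for g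
  proof -
    obtain m n where mn: "m \<in> M" "n \<in> N" "[m, n] \<in> wdom L" "m \<cdot> n = g"
      using set_multE[OF \<open>g \<in> pg_set_mult L M N\<close>] by metis
    have "[pinv n, pinv m] \<in> wdom L" using word_inv_wdom[OF mn(3)] by simp
    hence "pinv n \<cdot> pinv m \<in> pg_set_mult L N M"
      using M_D(2)[OF mn(1)] N_D(2)[OF mn(2)] unfolding pg_set_mult_def by blast
    thus ?thesis using pinv_mult[OF mn(3)] mn(4) set_mult_commute by simp
  qed
qed (rule set_mult_mult)

end

sublocale two_normal \<subseteq> whole: two_normal p L \<Delta> S M "carrier L"
  by unfold_locales (rule M, rule partial_normal_carrier)

context two_normal begin

text \<open>The Frattini factorization with the whole locality in place of \<open>N\<close> gives
  \<open>f = hk\<close> with \<open>k\<close> in \<open>M\<close>. For \<open>x = mn\<close> the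
  conjugate becomes the product of \<open>k^-1\<close>, \<open>m^h\<close>, \<open>n^h\<close> and
  \<open>k\<close>, all of which lie in \<open>MN\<close>.\<close>

lemma set_mult_conj:
  assumes x: "x \<in> pg_set_mult L M N" and xf: "x \<in> conj_dom L f"
  shows "x \<up> f \<in> pg_set_mult L M N"
proof -
  have f: "f \<in> carrier L" and D0: "[pinv f] @ [x] @ [f] \<in> wdom L" using conj_domD[OF xf] by auto
  obtain h k where hk: "h \<in> carrier L" "k \<in> M \<inter> carrier L" "[h, k] \<in> wdom L" "f = h \<cdot> k"
    "S_elt L S f \<subseteq> word_conj_set L S [h, k]" "M \<inter> S \<subseteq> S_elt L S h"
    using whole.frattini_factorization[OF f S_elt_obj[OF f] subset_refl] by blast
  have kM: "k \<in> M" "k \<in> carrier L" "pinv k \<in> M" using hk M_D by auto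
  obtain m n where mn: "m \<in> M" "n \<in> N" "[m, n] \<in> wdom L" "m \<cdot> n = x" "S_elt L S x = word_conj_set L S [m, n]"
    using set_multE[OF x] .
  have c: "m \<in> carrier L" "n \<in> carrier L" using mn M_D N_D by auto
  have Di: "[pinv k, pinv h] \<in> wdom L" "pinv k \<cdot> pinv h = pinv f"
    using word_inv_wdom[OF hk(3)] pinv_mult[OF hk(3)] hk(4) by simp_all
  \<comment> \<open>The factorization of \<open>f\<close> is read backwards: an element of
    \<open>S_(f^-1)\<close> is conjugated by \<open>f^-1\<close> into \<open>S_f\<close> and then
    retraces the path along \<open>(h, k)\<close>.\<close>
  have Si: "S_elt L S (pinv f) \<subseteq> word_conj_set L S [pinv k, pinv h]"
  proof
    fix a assume a: "a \<in> S_elt L S (pinv f)"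
    hence b: "a \<up> pinv f \<in> S_elt L S f" "a \<up> pinv f \<up> f = a"
      using conj_pinv'[of a f] f by (auto simp: S_elt_def)
    let ?b = "a \<up> pinv f"
    have b': "?b \<in> word_conj_set L S [h, k]" using b hk(5) by auto
    have "?b \<up> h \<up> k = a" using word_conj_set_wprod(2)[OF hk(3) b'] b(2) hk(4) by simp
    moreover have "?b \<in> conj_dom L h" "?b \<up> h \<in> conj_dom L k" "?b \<up> h \<in> S" "?b \<in> S"
      using b' by (auto simp: S_elt_def)
    ultimately show "a \<in> word_conj_set L S [pinv k, pinv h]"
      using a conj_pinv[of ?b h] conj_pinv[of "?b \<up> h" k] by (auto simp: S_elt_def)
  qed
  from word_expand[of "[]" "pinv f" "[x, f]", OF _ Di Si] D0
  have "[pinv k, pinv h, x] @ [f] @ [] \<in> wdom L" "wprod L [pinv k, pinv h, x, f] = x \<up> f"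
    by (simp_all add: conj_elt_def)
  from word_expand[OF this(1) hk(3) hk(4)[symmetric] hk(5)] this(2)
  have "[pinv k, pinv h] @ [x] @ [h, k] \<in> wdom L" "wprod L [pinv k, pinv h, x, h, k] = x \<up> f" by simp_all
  from word_expand[OF this(1) mn(3,4)] this(2) mn(5)
  have D1: "[pinv k, pinv h, m, n, h, k] \<in> wdom L" "wprod L [pinv k, pinv h, m, n, h, k] = x \<up> f" by simp_all
  let ?w = "[pinv k, pinv h, m, h, pinv h, n, h, k]"
  have D: "?w \<in> wdom L"
  proof (rule wdomI[OF word_conj_set_obj[OF D1(1)]], rule subsetI)
    fix a assume a: "a \<in> word_conj_set L S [pinv k, pinv h, m, n, h, k]"
    \<comment> \<open>This element lies in \<open>S_h\<close>. As \<open>S_h\<close> contains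
      \<open>M \<inter> S\<close>, conjugation by \<open>m\<close> keeps it there, so
      \<open>h h^-1\<close> may be inserted between \<open>m\<close> and \<open>n\<close>.\<close>
    let ?c = "a \<up> pinv k \<up> pinv h"
    have "a \<up> pinv k \<in> S_elt L S (pinv h)" "a \<up> pinv k \<in> S" using a by (auto simp: S_elt_def)
    hence "?c \<in> S_elt L S h" using conj_pinv'[of "a \<up> pinv k" h] hk(1) by (auto simp: S_elt_def)
    moreover have cm: "?c \<in> S_elt L S m" using a by auto
    ultimately have "?c \<up> m \<in> S_elt L S h"
      using conj_mem_overgroup_iff[OF M mn(1) cm S_elt_subgroup[OF hk(1)] hk(6) S_elt_subset] by auto
    hence "?c \<up> m \<in> S_elt L S h" "?c \<up> m \<up> h \<in> S_elt L S (pinv h)" "?c \<up> m \<up> h \<up> pinv h = ?c \<up> m"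
      using conj_pinv[of "?c \<up> m" h] by (auto simp: S_elt_def)
    thus "a \<in> word_conj_set L S ?w" using a by auto
  qed
  have "concat [[pinv k], [pinv h], [m], [h, pinv h], [n], [h], [k]] \<in> wdom L" using D by simp
  from wprod_concat[OF this] have
    D2: "concat [[pinv k], [pinv h], [m], [\<e>, n], [h], [k]] \<in> wdom L" and
    "wprod L [pinv k, pinv h, m, \<e>, n, h, k] = wprod L ?w"
    using hk(1) kM c by (simp_all add: wprod_singleton)
  hence "wprod L ?w = x \<up> f"
    using wprod_concat(2)[OF D2] D1(2) hk(1) kM c by (simp add: wprod_singleton)
  moreover have "concat [[pinv k], [pinv h, m, h], [pinv h, n, h], [k]] \<in> wdom L" using D by simp
  from wprod_concat[OF this] have
    D3: "[pinv k, m \<up> h, n \<up> h, k] \<in> wdom L" "wprod L [pinv k, m \<up> h, n \<up> h, k] = wprod L ?w"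
    using kM by (simp_all add: wprod_singleton conj_elt_def)
  have "[pinv h, m, h] \<in> wdom L" "[pinv h, n, h] \<in> wdom L"
    using append_wdomD2[of "[pinv k]" "[pinv h, m, h, pinv h, n, h, k]"]
      append_wdomD1[of "[pinv h, m, h]" "[pinv h, n, h, k]"]
      append_wdomD2[of "[pinv h, m, h]" "[pinv h, n, h, k]"]
      append_wdomD1[of "[pinv h, n, h]" "[k]"] D by simp_all
  hence "m \<up> h \<in> M" "n \<up> h \<in> N"
    using partial_normalD(2)[OF M mn(1) conj_domI] partial_normalD(2)[OF N mn(2) conj_domI] by simp_all
  hence "[pinv k, m \<up> h, n \<up> h, k] \<in> lists (pg_set_mult L M N)"
    using set_mult_superset kM by auto
  ultimately show ?thesis
    using partial_subgroupD(3)[OF set_mult_partial_subgroup] D3 by metis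
qed

lemma set_mult_partial_normal: "partial_normal_subgroup L (pg_set_mult L M N)"
  using set_mult_partial_subgroup set_mult_conj by (auto simp: partial_normal_subgroup_def)

text \<open>For \<open>g = mn\<close> in \<open>S\<close> chosen with \<open>S_g = S_(m,n)\<close>,
  the factor \<open>m\<close> normalizes \<open>S\<close> and lies in both \<open>MS\<close> and
  \<open>NS\<close>, hence in \<open>(M \<inter> N)S\<close>. Its representative \<open>s\<close>
  gives the factorization \<open>g = s (s^-1 g)\<close>.\<close>

lemma set_mult_Int_S: "pg_set_mult L M N \<inter> S = pg_set_mult L (M \<inter> S) (N \<inter> S)"
proof
  show "pg_set_mult L (M \<inter> S) (N \<inter> S) \<subseteq> pg_set_mult L M N \<inter> S"
    using S_D(6) by (auto simp: pg_set_mult_def)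
  show "pg_set_mult L M N \<inter> S \<subseteq> pg_set_mult L (M \<inter> S) (N \<inter> S)"
  proof
    fix g assume g: "g \<in> pg_set_mult L M N \<inter> S"
    then obtain m n where mn: "m \<in> M" "n \<in> N" "[m, n] \<in> wdom L" "m \<cdot> n = g" "S_elt L S g = word_conj_set L S [m, n]"
      using set_multE by blast
    have c: "m \<in> carrier L" "n \<in> carrier L" using mn M_D N_D by auto
    have gS: "g \<in> S" using g by auto
    have "S \<subseteq> word_conj_set L S [m, n]" using mn(5) S_conj[OF gS] by auto
    hence "S \<subseteq> S_elt L S m" by auto
    hence m: "m \<in> normalizer_of S" using c by (intro normalizerI) (auto simp: S_elt_def)
    have "[m, n, pinv n] \<in> wdom L" "wprod L [m, n, pinv n] = m"
      using cancel_right[of "[m]" "[n]"] mn(3) c by (simp_all add: wprod_singleton)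
    hence "[g, pinv n] \<in> wdom L" "g \<cdot> pinv n = m"
      using assoc_wdom[of "[]" "[m, n]" "[pinv n]"] assoc_wprod[of "[]" "[m, n]" "[pinv n]"] mn(4) by simp_all
    hence "m \<in> S_product N"
      using partial_subgroupD(5)[OF S_product_subgroup(1)[OF N], of g "pinv n"] S_product_subgroup(2,3)[OF N]
        gS mn(2) N_D(2) by blast
    \<comment> \<open>By \<open>sylow_S\<close> the normalizer of \<open>S\<close> in
      \<open>J\<close> is covered by \<open>(M \<inter> N)S\<close>, so a single \<open>s\<close>
      serves for both \<open>M\<close> and \<open>N\<close>.\<close>
    hence "m \<in> S_product (M \<inter> N)"
      using sylow_normalizer_S_product[OF M N S_obj] sylow_S m mn(1) S_product_subgroup(3)[OF M]
      unfolding J_def by blast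
    then obtain s where s: "in_coset M m s" "in_coset N m s" by (auto simp: S_product_def in_coset_Int)
    have sS: "s \<in> S" "s \<in> carrier L" using in_coset_carrier(2)[OF s(1)] S_D by auto
    \<comment> \<open>As \<open>m\<close> lies in \<open>M\<close> as well as in \<open>Ms\<close>,
      the representative \<open>s\<close> lies in \<open>M\<close>. Below, \<open>g\<close> in
      \<open>Ns\<close> gives \<open>s^-1 g\<close> in \<open>N\<close>.\<close>
    have "in_coset M (pinv m \<cdot> m) (pinv s \<cdot> \<e>)"
      using in_coset_mult[OF M in_coset_pinv[OF M s(1)], of m \<e>] in_coset_punit_iff c mn(1) by auto
    hence sM: "s \<in> M" using c sS by (simp add: in_coset_def winv_winv)
    have "in_coset N g (s \<cdot> \<e>)"
      using in_coset_mult[OF N s(2), of n \<e>] in_coset_punit_iff c mn by auto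
    hence "in_coset N (pinv g) (pinv s)" using in_coset_pinv[OF N, of g s] sS by simp
    hence "pinv g \<cdot> s \<in> N" using sS by (simp add: in_coset_def winv_winv)
    moreover have gs: "[pinv g, s] \<in> wdom L" "g \<in> carrier L" using gS sS S_D by auto
    ultimately have sg: "pinv s \<cdot> g \<in> N"
      using pinv_mult[OF gs(1)] N_D(2)[of "pinv g \<cdot> s"] gs by (simp add: winv_winv)
    have "[s, pinv s, g] \<in> wdom L" using gS sS S_D by auto
    hence D: "concat [[s], [pinv s, g]] \<in> wdom L" "concat [[s, pinv s], [g]] \<in> wdom L" by simp_all
    have "s \<cdot> (pinv s \<cdot> g) = g"
      using wprod_concat(2)[OF D(1)] wprod_concat(2)[OF D(2)] sS gs by (simp add: wprod_singleton)
    moreover have "pinv s \<cdot> g \<in> S" using sS gS S_D by auto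
    moreover have "[s, pinv s \<cdot> g] \<in> wdom L" using wprod_concat(1)[OF D(1)] sS by (simp add: wprod_singleton)
    ultimately show "g \<in> pg_set_mult L (M \<inter> S) (N \<inter> S)"
      using sM sg sS unfolding pg_set_mult_def by force
  qed
qed

end

theorem theorem1:
  fixes L :: "('a, 'b) partial_group_scheme"
    and p :: nat and \<Delta> :: "'a set set" and S M N :: "'a set"
  assumes "locality p L \<Delta> S"
    and "partial_normal_subgroup L M"
    and "partial_normal_subgroup L N"
  shows "pg_set_mult L M N = pg_set_mult L N M \<and>
    partial_normal_subgroup L (pg_set_mult L M N) \<and>
    pg_set_mult L M N \<inter> S = pg_set_mult L (M \<inter> S) (N \<inter> S) \<and>
    (\<forall>g\<in>pg_set_mult L M N. \<exists>m\<in>M. \<exists>n\<in>N.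
       [m, n] \<in> wdom L \<and> g = wprod L [m, n] \<and> S_elt L S g = S_word L S [m, n])"
proof -
  interpret two_normal p L \<Delta> S M N
    using assms by (simp add: two_normal_def two_normal_axioms_def)
  show ?thesis
    using set_mult_commute set_mult_partial_normal set_mult_Int_S S_word_eq[OF S_D(3)]
    by (metis set_multE)
qed

end
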